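(* Let $H$ be a separable complex Hilbert space, $D=D^*$ with compact resolvent, $\{h_m\}_{m\ge1}$ an orthonormal basis of eigenvectors of $D$, $G$ a positive bounded Borel function with $0<G(D)\in\mathcal{L}^{1,\infty}(H)$, and $U:H\to L^2(F,\mu)$ a joint spectral representation of commuting bounded selfadjoint operators $A_1,\dots,A_n$ acting non-degenerately on $H$. For $\omega\in DL_2$ and Borel $J\subset F$ put $\nu_{G,\omega}(J):=\mathrm{Tr}_\omega(T_{\chi_J}G(D)T_{\chi_J})$, where $T_f=U^*M_fU$. If $$\liminf_{N\to\infty}\liminf_{m\to\infty}\langle h_m,P_Nh_m\rangle=\liminf_{N\to\infty}\liminf_{m\to\infty}\int_{\bigcup_{j=N}^\infty F_j}|(Uh_m)(x)|^2\,d\mu(x)>0$$ for some sequence of disjoint Borel sets $F_j\subset F$, with projections $P_N=\sum_{j=N}^\infty T_{\chi_{F_j}}$, then $\nu_{G,\mathcal{L}(\xi)}$ is not a measure for any $\xi\in BL\cap DL$.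
   Context: $\mu_n(T)$ are the singular values of a compact operator $T$; $\mathcal{L}^{1,\infty}(H)$ is the ideal of compact $T$ with $\sup_{k}\frac{1}{\log(1+k)}\sum_{n=1}^k\mu_n(T)<\infty$. For $0<T\in\mathcal{L}^{1,\infty}$, $\gamma(T)=\{\frac{1}{\log(1+k)}\sum_{n=1}^k\mu_n(T)\}_{k}$. On $\ell^\infty$ let $T_j(\{a_k\})=\{a_{k+j}\}_k$ and $D_j(\{a_k\})=\{a_{\lceil k/j\rceil}\}_k$, $j\in\mathbb{N}$. $BL$ (resp. $DL$) is the set of states $\omega$ on $\ell^\infty$ (positive, $\omega(1)=1$) with $\omega\circ T_j=\omega$ (resp. $\omega\circ D_j=\omega$) for all $j$. $DL_2$ is the set of states $\omega$ on $\ell^\infty$ with $\liminf_k a_k\le\omega(\{a_k\})\le\limsup_k a_k$ for bounded $a_k\ge0$ and $\omega(D_2(\gamma(T)))=\omega(\gamma(T))$ for all $0<T\in\mathcal{L}^{1,\infty}$. $\mathrm{Tr}_\omega$ is the linear extension to $\mathcal{L}^{1,\infty}$ of $T\mapsto\omega(\gamma(T))$, $T>0$. The map $\mathcal{L}:(\ell^\infty)^*\to(\ell^\infty)^*$ is $\mathcal{L}(\omega)=\omega\circ\mathcal{E}\circ L^{-1}\circ p$, where $p(\{a_k\})(t)=\sum_ka_k\chi_{[k,k+1)}(t)$, $t\ge1$; $L^{-1}(g)(t)=g(e^t)$ for $g\in L^\infty([1,\infty))$, $t\ge0$; $\mathcal{E}(f)_k=\int_{k-1}^kf(t)\,dt$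 for $f\in L^\infty([0,\infty))$. It is known that $\mathcal{L}(\xi)\in DL_2$ for $\xi\in BL\cap DL$. A joint spectral representation is a unitary $U:H\to L^2(F,\mu)$, $(F,\mu)$ a finite Borel measure space, with $UA_iU^*=M_{e_i}$, $e_i$ bounded; it is assumed that there is a normal $^*$-homomorphism $f\mapsto f\circ e$, $e=(e_1,\dots,e_n)$, from the von Neumann algebra $\mathcal{M}\cong L^\infty(E,\mu_\eta)$ generated by the $A_i$ ($E$ the joint spectrum, $\mu_\eta$ a finite regular Borel measure on $E$) into $L^\infty(F,\mu)$ with $Uf(A_1,\dots,A_n)U^*=M_{f\circ e}$. $M_f$ is multiplication by $f$, $\chi_J$ the characteristic function of $J$.
   Formalization: The conclusion is asserted only for those ξ in BL∩DL with Tr_{L(ξ)}(G(D)) ≠ 0; when this trace vanishes (e.g. G(D) trace class), ν_{G,L(ξ)} is identically zero and hence is a measure, so the claim as stated fails there. *)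

theory Defs
  imports "HOL-Analysis.Analysis"
begin

section \<open>Complex Hilbert spaces and operators\<close>

text \<open>The inner product is conjugate-linear in the first argument. Positive definiteness is
  part of the last axiom, since \<^const>\<open>sqrt\<close> is negative on negative reals.\<close>

class chilbert_space = banach +
  fixes scaleC :: "complex \<Rightarrow> 'a \<Rightarrow> 'a" (infixr "*\<^sub>C" 75)
    and cinner :: "'a \<Rightarrow> 'a \<Rightarrow> complex"
  assumes scaleR_scaleC: "r *\<^sub>R x = complex_of_real r *\<^sub>C x"
    and scaleC_add_right: "c *\<^sub>C (x + y) = c *\<^sub>C x + c *\<^sub>C y"
    and scaleC_add_left: "(c + d) *\<^sub>C x = c *\<^sub>C x + d *\<^sub>C x"
    and scaleC_scaleC: "c *\<^sub>C d *\<^sub>C x = (c * d) *\<^sub>C x"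
    and scaleC_one: "1 *\<^sub>C x = x"
    and cinner_commute: "cinner x y = cnj (cinner y x)"
    and cinner_add_right: "cinner x (y + z) = cinner x y + cinner x z"
    and cinner_scaleC_right: "cinner x (c *\<^sub>C y) = c * cinner x y"
    and norm_eq_sqrt_cinner: "norm x = sqrt (Re (cinner x x))"

interpretation cvec: vector_space "scaleC :: complex \<Rightarrow> 'a \<Rightarrow> 'a::chilbert_space"
  by unfold_locales
    (simp_all add: scaleC_add_right scaleC_add_left scaleC_scaleC scaleC_one)

instantiation complex :: chilbert_space
begin
definition scaleC_complex :: "complex \<Rightarrow> complex \<Rightarrow> complex"
  where "scaleC_complex c x = c * x"
definition cinner_complex :: "complex \<Rightarrow> complex \<Rightarrow> complex"
  where "cinner_complex x y = cnj x * y"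
instance
  by standard
    (auto simp: scaleC_complex_def cinner_complex_def algebra_simps scaleR_conv_of_real
      cmod_def power2_eq_square)
end

definition bounded_clinear :: "('h::chilbert_space \<Rightarrow> 'h) \<Rightarrow> bool" where
  "bounded_clinear T \<longleftrightarrow> bounded_linear T \<and> (\<forall>c x. T (c *\<^sub>C x) = c *\<^sub>C T x)"

definition self_adjoint :: "('h::chilbert_space \<Rightarrow> 'h) \<Rightarrow> bool" where
  "self_adjoint T \<longleftrightarrow> bounded_clinear T \<and> (\<forall>x y. cinner (T x) y = cinner x (T y))"

definition positive_op :: "('h::chilbert_space \<Rightarrow> 'h) \<Rightarrow> bool" where
  "positive_op T \<longleftrightarrow> bounded_clinear T \<and> (\<forall>x. cinner x (T x) \<in> \<real>\<^sub>\<ge>\<^sub>0)"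

definition cadjoint :: "('h::chilbert_space \<Rightarrow> 'h) \<Rightarrow> 'h \<Rightarrow> 'h" where
  "cadjoint T = (THE S. \<forall>x y. cinner (S x) y = cinner x (T y))"

definition compact_op :: "('h::chilbert_space \<Rightarrow> 'h) \<Rightarrow> bool" where
  "compact_op T \<longleftrightarrow> bounded_clinear T \<and> compact (closure (T ` cball 0 1))"

definition corthonormal :: "'h::chilbert_space set \<Rightarrow> bool" where
  "corthonormal B \<longleftrightarrow> (\<forall>x\<in>B. \<forall>y\<in>B. cinner x y = (if x = y then 1 else 0))"

definition orthonormal_basis :: "(nat \<Rightarrow> 'h::chilbert_space) \<Rightarrow> bool" where
  "orthonormal_basis h \<longleftrightarrow>
     (\<forall>i j. cinner (h i) (h j) = (if i = j then 1 else 0)) \<and> closure (cvec.span (range h)) = UNIV"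


section \<open>Unbounded operators and the Borel functional calculus\<close>

text \<open>An unbounded operator is a pair of a domain and a function, of which only the values on
  the domain matter. Self-adjointness says that the graph of the adjoint is the graph of the
  operator itself.\<close>

definition unbounded_self_adjoint :: "'h::chilbert_space set \<Rightarrow> ('h \<Rightarrow> 'h) \<Rightarrow> bool" where
  "unbounded_self_adjoint Dom D \<longleftrightarrow>
     cvec.subspace Dom \<and> closure Dom = UNIV \<and>
     (\<forall>x\<in>Dom. \<forall>y\<in>Dom. D (x + y) = D x + D y) \<and> (\<forall>c. \<forall>x\<in>Dom. D (c *\<^sub>C x) = c *\<^sub>C D x) \<and>
     (\<forall>y z. (\<forall>x\<in>Dom. cinner (D x) y = cinner x z) \<longleftrightarrow> y \<in> Dom \<and> D y = z)"

definition compact_resolvent :: "'h::chilbert_space set \<Rightarrow> ('h \<Rightarrow> 'h) \<Rightarrow> bool" where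
  "compact_resolvent Dom D \<longleftrightarrow>
     (\<exists>z R. compact_op R \<and> (\<forall>x. R x \<in> Dom \<and> D (R x) - z *\<^sub>C R x = x) \<and>
            (\<forall>x\<in>Dom. R (D x - z *\<^sub>C x) = x))"

definition projection_valued_measure :: "(real set \<Rightarrow> 'h::chilbert_space \<Rightarrow> 'h) \<Rightarrow> bool" where
  "projection_valued_measure P \<longleftrightarrow>
     (\<forall>B\<in>sets borel. self_adjoint (P B) \<and> P B \<circ> P B = P B) \<and>
     P UNIV = id \<and>
     (\<forall>B\<in>sets borel. \<forall>C\<in>sets borel. P (B \<inter> C) = P B \<circ> P C) \<and>
     (\<forall>C x. range C \<subseteq> sets borel \<and> disjoint_family C \<longrightarrow>
        (\<lambda>i::nat. P (C i) x) sums P (\<Union>i. C i) x)"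

definition scalar_measure :: "(real set \<Rightarrow> 'h::chilbert_space \<Rightarrow> 'h) \<Rightarrow> 'h \<Rightarrow> real measure" where
  "scalar_measure P x = measure_of UNIV (sets borel) (\<lambda>B. ennreal (Re (cinner x (P B x))))"

definition spectral_measure ::
    "'h::chilbert_space set \<Rightarrow> ('h \<Rightarrow> 'h) \<Rightarrow> (real set \<Rightarrow> 'h \<Rightarrow> 'h) \<Rightarrow> bool" where
  "spectral_measure Dom D P \<longleftrightarrow>
     projection_valued_measure P \<and>
     Dom = {x. integrable (scalar_measure P x) (\<lambda>t. t\<^sup>2)} \<and>
     (\<forall>x\<in>Dom. cinner x (D x) = complex_of_real (\<integral>t. t \<partial>scalar_measure P x))"

text \<open>The relation \<open>T = G(D)\<close>, for bounded Borel \<open>G\<close>. By the spectral theorem there is exactly one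
  such \<open>T\<close> for a self-adjoint \<open>D\<close>.\<close>

definition has_borel_calculus ::
    "'h::chilbert_space set \<Rightarrow> ('h \<Rightarrow> 'h) \<Rightarrow> (real \<Rightarrow> real) \<Rightarrow> ('h \<Rightarrow> 'h) \<Rightarrow> bool" where
  "has_borel_calculus Dom D G T \<longleftrightarrow>
     bounded_clinear T \<and>
     (\<exists>P. spectral_measure Dom D P \<and>
          (\<forall>x. cinner x (T x) = complex_of_real (\<integral>t. G t \<partial>scalar_measure P x)))"


section \<open>Singular values and the ideal $\mathcal L^{1,\infty}$\<close>

text \<open>The \<open>n\<close>-th singular value (\<open>n \<ge> 1\<close>) is the \<open>n\<close>-th entry in the decreasing list of the
  eigenvalues of $|T| = (T^*T)^{1/2}$ repeated according to multiplicity, i.e. the largest \<open>s\<close>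
  such that there are \<open>n\<close> orthonormal eigenvectors of $|T|$ with eigenvalues at least \<open>s\<close>
  (and 0 if the list of positive ones is shorter than \<open>n\<close>).\<close>

definition singular_value :: "('h::chilbert_space \<Rightarrow> 'h) \<Rightarrow> nat \<Rightarrow> real" where
  "singular_value T n =
     Sup {s. s = 0 \<or> s > 0 \<and> (\<exists>B. finite B \<and> card B = n \<and> corthonormal B \<and>
                (\<forall>v\<in>B. \<exists>t\<ge>s. cadjoint T (T v) = t\<^sup>2 *\<^sub>R v))}"

text \<open>Sequences are indexed by \<open>k \<ge> 1\<close>; the value at index 0 is irrelevant throughout.\<close>

definition gamma_seq :: "('h::chilbert_space \<Rightarrow> 'h) \<Rightarrow> nat \<Rightarrow> real" where
  "gamma_seq T k = (\<Sum>n=1..k. singular_value T n) / ln (1 + real k)"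

definition L1inf :: "('h::chilbert_space \<Rightarrow> 'h) set" where
  "L1inf = {T. compact_op T \<and> bdd_above (gamma_seq T ` {1..})}"


section \<open>States on $\ell^\infty$\<close>

definition linfty :: "(nat \<Rightarrow> complex) set" where
  "linfty = {a. bounded (a ` {1..})}"

text \<open>Positivity only looks at indices \<open>k \<ge> 1\<close>; together with linearity this forces \<open>\<omega> a\<close> not to
  depend on \<open>a 0\<close>, so that states are functionals on $\ell^\infty(\{1,2,\dots\})$.\<close>

definition states :: "((nat \<Rightarrow> complex) \<Rightarrow> complex) set" where
  "states = {\<omega>.
     (\<forall>a\<in>linfty. \<forall>b\<in>linfty. \<omega> (\<lambda>k. a k + b k) = \<omega> a + \<omega> b) \<and>
     (\<forall>c. \<forall>a\<in>linfty. \<omega> (\<lambda>k. c * a k) = c * \<omega> a) \<and>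
     (\<forall>a\<in>linfty. (\<forall>k\<ge>1. a k \<in> \<real>\<^sub>\<ge>\<^sub>0) \<longrightarrow> \<omega> a \<in> \<real>\<^sub>\<ge>\<^sub>0) \<and>
     \<omega> (\<lambda>k. 1) = 1}"

definition translate :: "nat \<Rightarrow> (nat \<Rightarrow> 'a) \<Rightarrow> nat \<Rightarrow> 'a" where
  "translate j a = (\<lambda>k. a (k + j))"

definition dilate :: "nat \<Rightarrow> (nat \<Rightarrow> 'a) \<Rightarrow> nat \<Rightarrow> 'a" where
  "dilate j a = (\<lambda>k. a (nat \<lceil>real k / real j\<rceil>))"

definition BL :: "((nat \<Rightarrow> complex) \<Rightarrow> complex) set" where
  "BL = {\<omega>\<in>states. \<forall>j\<ge>1. \<forall>a\<in>linfty. \<omega> (translate j a) = \<omega> a}"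

definition DL :: "((nat \<Rightarrow> complex) \<Rightarrow> complex) set" where
  "DL = {\<omega>\<in>states. \<forall>j\<ge>1. \<forall>a\<in>linfty. \<omega> (dilate j a) = \<omega> a}"

definition DL2 :: "'h::chilbert_space itself \<Rightarrow> ((nat \<Rightarrow> complex) \<Rightarrow> complex) set" where
  "DL2 _ = {\<omega>\<in>states.
     (\<forall>a::nat \<Rightarrow> real. bounded (a ` {1..}) \<and> (\<forall>k\<ge>1. 0 \<le> a k) \<longrightarrow>
        liminf (\<lambda>k. ereal (a k)) \<le> ereal (Re (\<omega> (\<lambda>k. of_real (a k)))) \<and>
        ereal (Re (\<omega> (\<lambda>k. of_real (a k)))) \<le> limsup (\<lambda>k. ereal (a k))) \<and>
     (\<forall>T\<in>L1inf :: ('h \<Rightarrow> 'h) set. positive_op T \<and> T \<noteq> (\<lambda>x. 0) \<longrightarrow>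
        \<omega> (dilate 2 (\<lambda>k. of_real (gamma_seq T k))) = \<omega> (\<lambda>k. of_real (gamma_seq T k)))}"

definition p_map :: "(nat \<Rightarrow> complex) \<Rightarrow> real \<Rightarrow> complex" where
  "p_map a t = (\<Sum>k. a (Suc k) * indicator {real (Suc k)..<real (Suc k) + 1} t)"

definition L_inv :: "(real \<Rightarrow> complex) \<Rightarrow> real \<Rightarrow> complex" where
  "L_inv g t = g (exp t)"

definition E_map :: "(real \<Rightarrow> complex) \<Rightarrow> nat \<Rightarrow> complex" where
  "E_map f k = integral {real k - 1..real k} f"

definition L_map :: "((nat \<Rightarrow> complex) \<Rightarrow> complex) \<Rightarrow> (nat \<Rightarrow> complex) \<Rightarrow> complex" where
  "L_map \<omega> = \<omega> \<circ> E_map \<circ> L_inv \<circ> p_map"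


section \<open>The Dixmier trace\<close>

text \<open>Positive part of a self-adjoint operator (Jordan decomposition); the negative part of \<open>S\<close>
  is the positive part of \<open>-S\<close>.\<close>

definition pos_part :: "('h::chilbert_space \<Rightarrow> 'h) \<Rightarrow> 'h \<Rightarrow> 'h" where
  "pos_part S = (THE P. positive_op P \<and>
     (\<exists>N. positive_op N \<and> (\<forall>x. S x = P x - N x) \<and> (\<forall>x. P (N x) = 0)))"

definition re_part :: "('h::chilbert_space \<Rightarrow> 'h) \<Rightarrow> 'h \<Rightarrow> 'h" where
  "re_part T = (\<lambda>x. (1/2) *\<^sub>C (T x + cadjoint T x))"

definition im_part :: "('h::chilbert_space \<Rightarrow> 'h) \<Rightarrow> 'h \<Rightarrow> 'h" where
  "im_part T = (\<lambda>x. (1/(2*\<i>)) *\<^sub>C (T x - cadjoint T x))"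

text \<open>\<open>T \<mapsto> \<omega> (\<gamma> T)\<close> on the positive cone, extended to all operators through
  $T = (\Re T)_+ - (\Re T)_- + i((\Im T)_+ - (\Im T)_-)$. For \<open>\<omega>\<close> in \<^const>\<open>DL2\<close> the map is additive
  on the positive cone of \<^const>\<open>L1inf\<close>, and this is its unique linear extension.\<close>

definition dixmier_trace ::
    "((nat \<Rightarrow> complex) \<Rightarrow> complex) \<Rightarrow> ('h::chilbert_space \<Rightarrow> 'h) \<Rightarrow> complex" where
  "dixmier_trace \<omega> T =
     (let w = (\<lambda>S::'h \<Rightarrow> 'h. \<omega> (\<lambda>k. of_real (gamma_seq S k))) in
        w (pos_part (re_part T)) - w (pos_part (\<lambda>x. - re_part T x))
        + \<i> * (w (pos_part (im_part T)) - w (pos_part (\<lambda>x. - im_part T x))))"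


section \<open>Unitaries onto $L^2(F,\mu)$ and joint spectral representations\<close>

text \<open>Elements of $L^2$ and $L^\infty$ are represented by functions, equality being equality
  almost everywhere.\<close>

definition L2_fun :: "'a measure \<Rightarrow> ('a \<Rightarrow> complex) set" where
  "L2_fun M = {g \<in> borel_measurable M. integrable M (\<lambda>x. (norm (g x))\<^sup>2)}"

definition Linf_fun :: "'a measure \<Rightarrow> ('a \<Rightarrow> complex) set" where
  "Linf_fun M = {g \<in> borel_measurable M. \<exists>C::real. AE x in M. norm (g x) \<le> C}"

definition unitary_onto_L2 :: "'f measure \<Rightarrow> ('h::chilbert_space \<Rightarrow> 'f \<Rightarrow> complex) \<Rightarrow> bool" where
  "unitary_onto_L2 \<mu> U \<longleftrightarrow>
     (\<forall>v. U v \<in> L2_fun \<mu>) \<and>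
     (\<forall>v w. AE x in \<mu>. U (v + w) x = U v x + U w x) \<and>
     (\<forall>c v. AE x in \<mu>. U (c *\<^sub>C v) x = c * U v x) \<and>
     (\<forall>v w. cinner v w = (\<integral>x. cnj (U v x) * U w x \<partial>\<mu>)) \<and>
     (\<forall>g\<in>L2_fun \<mu>. \<exists>v. AE x in \<mu>. U v x = g x)"

text \<open>$T_f = U^* M_f U$, where $U^* = U^{-1}$.\<close>

definition mult_op ::
    "'f measure \<Rightarrow> ('h::chilbert_space \<Rightarrow> 'f \<Rightarrow> complex) \<Rightarrow> ('f \<Rightarrow> complex) \<Rightarrow> 'h \<Rightarrow> 'h" where
  "mult_op \<mu> U f v = (THE w. AE x in \<mu>. U w x = f x * U v x)"

definition commutant :: "('h::chilbert_space \<Rightarrow> 'h) set \<Rightarrow> ('h \<Rightarrow> 'h) set" where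
  "commutant S = {T. bounded_clinear T \<and> (\<forall>A\<in>S. T \<circ> A = A \<circ> T)}"

text \<open>The von Neumann algebra generated by a self-adjoint set, as its bicommutant.\<close>

definition vN_algebra :: "('h::chilbert_space \<Rightarrow> 'h) set \<Rightarrow> ('h \<Rightarrow> 'h) set" where
  "vN_algebra S = commutant (commutant S)"

text \<open>The joint spectrum in the commutative algebra generated by the \<open>A\<^sub>i\<close>: the points \<open>c\<close> for
  which the ideal generated by the \<open>A\<^sub>i - c\<^sub>i\<close> is proper, i.e. the points
  $(\phi(A_1),\dots,\phi(A_n))$ with $\phi$ a character. It is real for self-adjoint \<open>A\<^sub>i\<close>.\<close>

definition joint_spectrum :: "('n::finite \<Rightarrow> 'h::chilbert_space \<Rightarrow> 'h) \<Rightarrow> (real^'n) set" where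
  "joint_spectrum A = {c. \<not> (\<exists>B. (\<forall>i. B i \<in> vN_algebra (range A)) \<and>
     (\<forall>v. (\<Sum>i\<in>UNIV. B i (A i v - (c $ i) *\<^sub>R v)) = v))}"

text \<open>\<open>\<Psi>\<close> is the functional calculus \<open>f \<mapsto> f(A\<^sub>1,\<dots>,A\<^sub>n)\<close>: a *-isomorphism of $L^\infty(\eta)$ onto
  the von Neumann algebra generated by the \<open>A\<^sub>i\<close> which maps the coordinate functions to the
  \<open>A\<^sub>i\<close>. (A *-isomorphism of von Neumann algebras is normal, so this determines \<open>\<Psi>\<close>.)\<close>

definition joint_calculus ::
    "('n::finite \<Rightarrow> 'h::chilbert_space \<Rightarrow> 'h) \<Rightarrow> (real^'n) measure \<Rightarrow>
     ((real^'n \<Rightarrow> complex) \<Rightarrow> 'h \<Rightarrow> 'h) \<Rightarrow> bool" where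
  "joint_calculus A \<eta> \<Psi> \<longleftrightarrow>
     \<Psi> ` Linf_fun \<eta> = vN_algebra (range A) \<and>
     (\<forall>f\<in>Linf_fun \<eta>. \<forall>g\<in>Linf_fun \<eta>. \<Psi> f = \<Psi> g \<longleftrightarrow> (AE x in \<eta>. f x = g x)) \<and>
     (\<forall>f\<in>Linf_fun \<eta>. \<forall>g\<in>Linf_fun \<eta>. \<forall>v. \<Psi> (\<lambda>x. f x + g x) v = \<Psi> f v + \<Psi> g v) \<and>
     (\<forall>c. \<forall>f\<in>Linf_fun \<eta>. \<forall>v. \<Psi> (\<lambda>x. c * f x) v = c *\<^sub>C \<Psi> f v) \<and>
     (\<forall>f\<in>Linf_fun \<eta>. \<forall>g\<in>Linf_fun \<eta>. \<Psi> (\<lambda>x. f x * g x) = \<Psi> f \<circ> \<Psi> g) \<and>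
     (\<forall>f\<in>Linf_fun \<eta>. \<forall>v w. cinner (\<Psi> (\<lambda>x. cnj (f x)) v) w = cinner v (\<Psi> f w)) \<and>
     (\<forall>i. \<Psi> (\<lambda>x. complex_of_real (x $ i)) = A i)"

definition real_Linf :: "'a measure \<Rightarrow> ('a \<Rightarrow> real) set" where
  "real_Linf M = {f \<in> borel_measurable M. \<exists>C::real. AE x in M. \<bar>f x\<bar> \<le> C}"

definition is_lub_Linf :: "'a measure \<Rightarrow> ('a \<Rightarrow> real) set \<Rightarrow> ('a \<Rightarrow> real) \<Rightarrow> bool" where
  "is_lub_Linf M S g \<longleftrightarrow>
     g \<in> real_Linf M \<and> (\<forall>f\<in>S. AE x in M. f x \<le> g x) \<and>
     (\<forall>g'\<in>real_Linf M. (\<forall>f\<in>S. AE x in M. f x \<le> g' x) \<longrightarrow> (AE x in M. g x \<le> g' x))"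

text \<open>\<open>f \<mapsto> f \<circ> e\<close> is a well-defined normal *-homomorphism $L^\infty(\eta)\to L^\infty(\mu)$.
  Compatibility with sums, products and conjugation holds pointwise, so what remains is that
  the map respects classes and suprema of bounded upward directed families.\<close>

definition normal_composition_hom ::
    "'a measure \<Rightarrow> 'f measure \<Rightarrow> ('f \<Rightarrow> 'a) \<Rightarrow> bool" where
  "normal_composition_hom \<eta> \<mu> e \<longleftrightarrow>
     (\<forall>f\<in>Linf_fun \<eta>. f \<circ> e \<in> Linf_fun \<mu>) \<and>
     (\<forall>f\<in>Linf_fun \<eta>. \<forall>g\<in>Linf_fun \<eta>.
        (AE x in \<eta>. f x = g x) \<longrightarrow> (AE x in \<mu>. f (e x) = g (e x))) \<and>
     (\<forall>S g. S \<noteq> {} \<and> S \<subseteq> real_Linf \<eta> \<and>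
        (\<forall>f1\<in>S. \<forall>f2\<in>S. \<exists>f3\<in>S. AE x in \<eta>. f1 x \<le> f3 x \<and> f2 x \<le> f3 x) \<and>
        is_lub_Linf \<eta> S g \<longrightarrow> is_lub_Linf \<mu> ((\<lambda>f. f \<circ> e) ` S) (g \<circ> e))"

text \<open>The measure \<open>\<mu>\<^sub>\<eta>\<close> on the joint spectrum is a Borel measure on \<open>real^'n\<close> vanishing off the
  joint spectrum; its regularity is automatic, being a finite Borel measure on a Polish
  space.\<close>

definition joint_spectral_representation ::
    "('n::finite \<Rightarrow> 'h::chilbert_space \<Rightarrow> 'h) \<Rightarrow> 'f::topological_space set \<Rightarrow> 'f measure \<Rightarrow>
     ('h \<Rightarrow> 'f \<Rightarrow> complex) \<Rightarrow> ('f \<Rightarrow> real^'n) \<Rightarrow> bool" where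
  "joint_spectral_representation A F \<mu> U e \<longleftrightarrow>
     finite_measure \<mu> \<and> sets \<mu> = sets (restrict_space borel F) \<and>
     unitary_onto_L2 \<mu> U \<and>
     e \<in> borel_measurable \<mu> \<and> bounded (e ` F) \<and>
     (\<forall>i v. AE x in \<mu>. U (A i v) x = complex_of_real (e x $ i) * U v x) \<and>
     (\<exists>\<eta> \<Psi>. finite_measure \<eta> \<and> sets \<eta> = sets borel \<and> (AE x in \<eta>. x \<in> joint_spectrum A) \<and>
        joint_calculus A \<eta> \<Psi> \<and> normal_composition_hom \<eta> \<mu> e \<and>
        (\<forall>f\<in>Linf_fun \<eta>. \<forall>v. AE x in \<mu>. U (\<Psi> f v) x = f (e x) * U v x))"


section \<open>The set functions $\nu_{G,\omega}$ and the projections $P_N$\<close>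

definition nu ::
    "'f measure \<Rightarrow> ('h::chilbert_space \<Rightarrow> 'f \<Rightarrow> complex) \<Rightarrow> ('h \<Rightarrow> 'h) \<Rightarrow>
     ((nat \<Rightarrow> complex) \<Rightarrow> complex) \<Rightarrow> 'f set \<Rightarrow> complex" where
  "nu \<mu> U GD \<omega> J =
     dixmier_trace \<omega> (mult_op \<mu> U (indicator J) \<circ> GD \<circ> mult_op \<mu> U (indicator J))"

text \<open>\<open>\<nu>\<close>, given on the measurable sets of \<open>\<mu>\<close>, is a measure; as \<open>\<nu>\<close> has no infinite values, a
  finite one. The zero measure counts as a measure: \<^const>\<open>nu\<close> vanishes identically as soon as
  $\mathrm{Tr}_\omega(G(D)) = 0$ (for instance if \<open>G(D)\<close> is trace class), so a theorem saying that
  \<^const>\<open>nu\<close> is not a measure needs $\mathrm{Tr}_\omega(G(D)) \neq 0$.\<close>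

definition is_measure_on :: "'f measure \<Rightarrow> ('f set \<Rightarrow> complex) \<Rightarrow> bool" where
  "is_measure_on \<mu> \<nu> \<longleftrightarrow>
     (\<exists>M. finite_measure M \<and> sets M = sets \<mu> \<and>
          (\<forall>J\<in>sets \<mu>. \<nu> J = complex_of_real (measure M J)))"

text \<open>The sum converges strongly.\<close>

definition tail_projection ::
    "'f measure \<Rightarrow> ('h::chilbert_space \<Rightarrow> 'f \<Rightarrow> complex) \<Rightarrow> (nat \<Rightarrow> 'f set) \<Rightarrow> nat \<Rightarrow> 'h \<Rightarrow> 'h" where
  "tail_projection \<mu> U Fs N v = (\<Sum>j. mult_op \<mu> U (indicator (Fs (N + j))) v)"

end

theory Submission
  imports Defs
begin

text \<open>Write $T = G(D)$ and $P = P_N$. The eigenvectors $h_m$ of $D$ are eigenvectors of $T$; let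
  $\lambda_m$ be the eigenvalues. The operators $P T P$ and $T^{1/2} P T^{1/2}$ have the same
  singular values, so by Ky Fan's maximum principle the sum of the first $k$ singular values of
  $P T P$ is at least $\sum_m \lambda_m \langle h_m, P h_m \rangle$, where \<open>m\<close> runs through the
  indices of the $k$ largest $\lambda_m$. If $\langle h_m, P h_m \rangle \ge c$ for all but
  finitely many \<open>m\<close>, then $\gamma(P T P) \ge c\,\gamma(T) - O(1/\log(1+k))$. For $\xi \in BL$ the
  functional $\mathcal L(\xi)$ is positive and kills null sequences, hence
  $\nu(\bigcup_{j \ge N} F_j) \ge c\,\mathrm{Tr}_{\mathcal L(\xi)}(T) > 0$ with \<open>c\<close> independent
  of \<open>N\<close>. These sets decrease to the empty set, so $\nu$ is not continuous from
  above.\<close>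

section \<open>Inner products\<close>

text \<open>Two objects are accessible only indirectly, and this shapes the proof. Singular values
  are defined through orthonormal eigenvectors of the square of |T|, so their sums can be handled
  only once the eigenvalues of T and of P T P are arranged in decreasing order. This is done by
  maximising the quadratic form successively on orthogonal complements; the maximality property then
  replaces every appeal to a spectral theorem for compact operators. For T the maximisers must be
  taken among the h_m, because the hypothesis concerns these vectors. Secondly, both D and G(D) are
  tied to a spectral measure by quadratic forms alone. No commutation is given, and polarization has
  to recover that each h_m is an eigenvector of G(D).

  The exceptional indices m may depend on N, but c does not. Their contribution to the partial sums
  is bounded in k, which is the origin of the error term. That L(xi) kills it needs only that
  averages over logarithmic blocks of a null sequence form a null sequence, and that xi does not see
  finitely many blocks.\<close>

lemma cinner_add_left: "cinner (x + y) z = cinner x z + cinner y (z::'h::chilbert_space)"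
  by (metis cinner_add_right cinner_commute complex_cnj_add)

lemma cinner_scaleC_left: "cinner (c *\<^sub>C x) y = cnj c * cinner x (y::'h::chilbert_space)"
  by (metis cinner_commute cinner_scaleC_right complex_cnj_mult)

lemma cinner_zero_right [simp]: "cinner x (0::'h::chilbert_space) = 0"
  using cinner_add_right[of x 0 0] by simp

lemma cinner_zero_left [simp]: "cinner (0::'h::chilbert_space) x = 0"
  using cinner_add_left[of 0 0 x] by simp

lemma cinner_minus_right: "cinner x (- y) = - cinner x (y::'h::chilbert_space)"
  using cinner_add_right[of x y "- y"] by (simp add: eq_neg_iff_add_eq_0 add.commute)

lemma cinner_diff_right: "cinner x (y - z) = cinner x y - cinner x (z::'h::chilbert_space)"
  using cinner_add_right[of x y "- z"] by (simp add: cinner_minus_right)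

lemma cinner_diff_left: "cinner (x - y) z = cinner x z - cinner y (z::'h::chilbert_space)"
  by (metis cinner_diff_right cinner_commute complex_cnj_diff)

lemma cinner_sum_right: "cinner x (sum f I) = (\<Sum>i\<in>I. cinner x (f i :: 'h::chilbert_space))"
  by (induction I rule: infinite_finite_induct) (auto simp: cinner_add_right)

lemma cinner_sum_left: "cinner (sum f I) x = (\<Sum>i\<in>I. cinner (f i :: 'h::chilbert_space) x)"
  by (induction I rule: infinite_finite_induct) (auto simp: cinner_add_left)

text \<open>Nonnegativity comes from the norm axiom: \<open>sqrt\<close> is negative on negative
  reals, so a nonnegative norm forces a nonnegative real part. Conjugate symmetry removes the
  imaginary part.\<close>

lemma cinner_self: "cinner x x = complex_of_real ((norm (x::'h::chilbert_space))\<^sup>2)"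
proof -
  have "0 \<le> Re (cinner x x)"
    using norm_ge_zero[of x] unfolding norm_eq_sqrt_cinner[of x] by (simp add: real_sqrt_ge_0_iff)
  moreover have "Im (cinner x x) = 0"
    using arg_cong[OF cinner_commute[of x x], of Im] by simp
  ultimately show ?thesis
    by (simp add: complex_eq_iff norm_eq_sqrt_cinner[of x] del: real_sqrt_ge_0_iff)
qed

lemma norm_scaleC: "norm (c *\<^sub>C x) = norm c * norm (x::'h::chilbert_space)"
proof -
  have "complex_of_real ((norm (c *\<^sub>C x))\<^sup>2) = (c * cnj c) * cinner x x"
    by (simp only: cinner_self[symmetric] cinner_scaleC_left cinner_scaleC_right mult_ac)
  also have "\<dots> = complex_of_real ((norm c * norm x)\<^sup>2)"
    by (simp only: complex_norm_square[symmetric] cinner_self power_mult_distrib of_real_mult)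
  finally have "complex_of_real ((norm (c *\<^sub>C x))\<^sup>2) = complex_of_real ((norm c * norm x)\<^sup>2)" .
  then show ?thesis
    by (metis norm_ge_zero mult_nonneg_nonneg of_real_eq_iff power2_eq_imp_eq)
qed

lemma cinner_ext: "(\<And>z. cinner z x = cinner z y) \<Longrightarrow> x = (y::'h::chilbert_space)"
  using cinner_self[of "x - y"] by (simp add: cinner_diff_right)

section \<open>Orthonormal families, quadratic forms and Bessel's inequality\<close>

definition orthonormal_family :: "'i set \<Rightarrow> ('i \<Rightarrow> 'h::chilbert_space) \<Rightarrow> bool" where
  "orthonormal_family I f \<longleftrightarrow>
     (\<forall>i\<in>I. \<forall>j\<in>I. cinner (f i) (f j) = (if i = j then 1 else 0))"

lemma orthonormal_familyD:
  "orthonormal_family I f \<Longrightarrow> i \<in> I \<Longrightarrow> j \<in> I \<Longrightarrow> cinner (f i) (f j) = (if i = j then 1 else 0)"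
  by (auto simp: orthonormal_family_def)

lemma orthonormal_family_subset: "orthonormal_family I f \<Longrightarrow> J \<subseteq> I \<Longrightarrow> orthonormal_family J f"
  unfolding orthonormal_family_def by blast

lemma norm_orthonormal_family: "orthonormal_family I f \<Longrightarrow> i \<in> I \<Longrightarrow> norm (f i) = 1"
  using orthonormal_familyD[of I f i i] norm_eq_sqrt_cinner[of "f i"] by simp

lemma bounded_clinearD:
  fixes S :: "'h::chilbert_space \<Rightarrow> 'h"
  assumes "bounded_clinear S"
  shows "S (x + y) = S x + S y" "S (c *\<^sub>C x) = c *\<^sub>C S x" "S 0 = 0" "S (x - y) = S x - S y"
    "S (sum f I) = (\<Sum>i\<in>I. S (f i))"
proof -
  interpret bounded_linear S using assms by (auto simp: bounded_clinear_def)
  show "S (x + y) = S x + S y" "S 0 = 0" "S (x - y) = S x - S y" "S (sum f I) = (\<Sum>i\<in>I. S (f i))"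
    by (auto simp: add diff sum)
  show "S (c *\<^sub>C x) = c *\<^sub>C S x" using assms by (auto simp: bounded_clinear_def)
qed

lemma bounded_clinearI:
  fixes S :: "'h::chilbert_space \<Rightarrow> 'h"
  assumes "\<And>x y. S (x + y) = S x + S y" "\<And>c x. S (c *\<^sub>C x) = c *\<^sub>C S x"
    and "\<And>x. norm (S x) \<le> norm x * K"
  shows "bounded_clinear S"
  unfolding bounded_clinear_def
  using assms by (auto intro!: bounded_linear_intro[where K = K] simp: scaleR_scaleC)

lemma bounded_clinear_compose:
  "bounded_clinear S \<Longrightarrow> bounded_clinear R \<Longrightarrow> bounded_clinear (S \<circ> R)"
  by (auto simp: bounded_clinear_def bounded_linear_compose o_def)

text \<open>\<open>S\<close> maps the span of the eigenvectors into itself, hence by symmetry also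
  its orthogonal complement, so no cross terms remain. For the identity this is Pythagoras; for T
  and P T P it feeds the eigenvalue estimates below.\<close>

lemma cinner_quadratic_expand:
  fixes S :: "'h::chilbert_space \<Rightarrow> 'h"
  assumes S: "self_adjoint S" and f: "orthonormal_family I f" "finite I"
    and eig: "\<And>i. i \<in> I \<Longrightarrow> S (f i) = complex_of_real (s i) *\<^sub>C f i"
    and r: "\<And>i. i \<in> I \<Longrightarrow> cinner (f i) r = 0"
  shows "cinner ((\<Sum>i\<in>I. d i *\<^sub>C f i) + r) (S ((\<Sum>i\<in>I. d i *\<^sub>C f i) + r)) =
    complex_of_real (\<Sum>i\<in>I. s i * (norm (d i))\<^sup>2) + cinner r (S r)"
proof -
  let ?y = "\<Sum>i\<in>I. d i *\<^sub>C f i"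
  have lin: "bounded_clinear S" and sym: "\<And>x y. cinner (S x) y = cinner x (S y)"
    using S by (auto simp: self_adjoint_def)
  have r': "cinner r (f i) = 0" if "i \<in> I" for i
    using r[OF that] by (subst cinner_commute) simp
  have Sy: "S ?y = (\<Sum>i\<in>I. (d i * complex_of_real (s i)) *\<^sub>C f i)"
    using eig by (auto simp: bounded_clinearD[OF lin] scaleC_scaleC intro!: sum.cong)
  have cross: "cinner r (S ?y) = 0"
    using r' by (simp add: Sy cinner_sum_right cinner_scaleC_right)
  have "cinner ?y (S r) = cnj (cinner r (S ?y))"
    by (metis sym cinner_commute)
  then have cross': "cinner ?y (S r) = 0" by (simp add: cross)
  have "cinner ?y (S ?y) =
      (\<Sum>i\<in>I. \<Sum>j\<in>I. cnj (d i) * (d j * complex_of_real (s j)) * cinner (f i) (f j))"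
    unfolding Sy cinner_sum_left
    by (simp add: cinner_sum_right cinner_scaleC_right cinner_scaleC_left sum_distrib_left mult_ac)
  also have "\<dots> = (\<Sum>i\<in>I. \<Sum>j\<in>I. if j = i then cnj (d i) * (d i * complex_of_real (s i)) else 0)"
    using orthonormal_familyD[OF f(1)] by (intro sum.cong refl) (auto cong: if_cong)
  also have "\<dots> = (\<Sum>i\<in>I. complex_of_real (s i * (norm (d i))\<^sup>2))"
  proof (intro sum.cong refl)
    fix i assume "i \<in> I"
    have "cnj (d i) * (d i * complex_of_real (s i)) = complex_of_real (s i) * (d i * cnj (d i))"
      by (simp only: mult_ac)
    also have "\<dots> = complex_of_real (s i * (norm (d i))\<^sup>2)"
      by (simp only: complex_norm_square[symmetric] of_real_mult)
    finally show "(\<Sum>j\<in>I. if j = i then cnj (d i) * (d i * complex_of_real (s i)) else 0) =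
        complex_of_real (s i * (norm (d i))\<^sup>2)"
      using f(2) \<open>i \<in> I\<close> by simp
  qed
  finally show ?thesis
    by (simp only: bounded_clinearD(1)[OF lin] cinner_add_left cinner_add_right cross cross'
        of_real_sum add_0_left add_0_right)
qed

lemma self_adjoint_id: "self_adjoint (\<lambda>x::'h::chilbert_space. x)"
  by (auto simp: self_adjoint_def intro!: bounded_clinearI[where K = 1])

lemma norm_orthogonal_expand:
  fixes f :: "'i \<Rightarrow> 'h::chilbert_space"
  assumes f: "orthonormal_family I f" "finite I" and r: "\<And>i. i \<in> I \<Longrightarrow> cinner (f i) r = 0"
  shows "(norm ((\<Sum>i\<in>I. d i *\<^sub>C f i) + r))\<^sup>2 = (\<Sum>i\<in>I. (norm (d i))\<^sup>2) + (norm r)\<^sup>2"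
proof -
  have "complex_of_real ((norm ((\<Sum>i\<in>I. d i *\<^sub>C f i) + r))\<^sup>2) =
      complex_of_real ((\<Sum>i\<in>I. (norm (d i))\<^sup>2) + (norm r)\<^sup>2)"
    using cinner_quadratic_expand[OF self_adjoint_id f, of "\<lambda>_. 1" r d] r
    by (simp add: cinner_self scaleC_one)
  then show ?thesis by (simp only: of_real_eq_iff)
qed

definition residual :: "'i set \<Rightarrow> ('i \<Rightarrow> 'h) \<Rightarrow> 'h \<Rightarrow> 'h::chilbert_space" where
  "residual I f x = x - (\<Sum>i\<in>I. cinner (f i) x *\<^sub>C f i)"

lemma residual_expand: "x = (\<Sum>i\<in>I. cinner (f i) x *\<^sub>C f i) + residual I f x"
  by (simp add: residual_def)

lemma residual_orthogonal:
  assumes "orthonormal_family I f" "finite I" "i \<in> I"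
  shows "cinner (f i) (residual I f x) = 0"
proof -
  have "(\<Sum>j\<in>I. cinner (f j) x * cinner (f i) (f j)) = (\<Sum>j\<in>I. if j = i then cinner (f i) x else 0)"
    using orthonormal_familyD[OF assms(1)] assms(3) by (intro sum.cong) auto
  then show ?thesis
    using assms by (simp add: residual_def cinner_diff_right cinner_sum_right cinner_scaleC_right)
qed

lemma norm_residual:
  assumes "orthonormal_family I f" "finite I"
  shows "(norm x)\<^sup>2 = (\<Sum>i\<in>I. (norm (cinner (f i) x))\<^sup>2) + (norm (residual I f x))\<^sup>2"
  using norm_orthogonal_expand[OF assms residual_orthogonal[OF assms, of _ x],
      of "\<lambda>i. cinner (f i) x"]
  by (simp add: residual_def)

lemma bessel:
  assumes "orthonormal_family I f" "finite I"
  shows "(\<Sum>i\<in>I. (norm (cinner (f i) x))\<^sup>2) \<le> (norm x)\<^sup>2"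
  using norm_residual[OF assms, of x] by simp

lemma norm_cinner_commute: "norm (cinner x y) = norm (cinner y (x::'h::chilbert_space))"
  by (metis cinner_commute complex_mod_cnj)

text \<open>Bessel's inequality for the one-element family consisting of the normalised
  \<open>x\<close>.\<close>

lemma cinner_cauchy_schwarz: "norm (cinner x y) \<le> norm x * norm (y::'h::chilbert_space)"
proof (cases "x = 0")
  case False
  let ?c = "complex_of_real (1 / norm x)"
  have "cinner (?c *\<^sub>C x) (?c *\<^sub>C x) = 1"
    using False by (simp add: cinner_self norm_scaleC norm_divide)
  then have "orthonormal_family {()} (\<lambda>_. ?c *\<^sub>C x)"
    by (simp add: orthonormal_family_def)
  from bessel[OF this, of y] have "norm (cinner (?c *\<^sub>C x) y) \<le> norm y"
    by (simp add: power2_le_iff_abs_le)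
  then show ?thesis
    using False by (simp add: cinner_scaleC_left norm_mult norm_divide field_simps)
qed simp

lemma bounded_linear_cinner: "bounded_linear (cinner (x::'h::chilbert_space))"
  by (rule bounded_linear_intro[where K = "norm x"])
    (use cinner_cauchy_schwarz[of x] in \<open>auto simp: cinner_add_right scaleR_scaleC[where 'a = 'h]
      cinner_scaleC_right scaleR_conv_of_real mult.commute\<close>)

lemma tendsto_cinner_right:
  "(y \<longlongrightarrow> l) A \<Longrightarrow> ((\<lambda>n. cinner x (y n)) \<longlongrightarrow> cinner x (l::'h::chilbert_space)) A"
  by (rule bounded_linear.tendsto[OF bounded_linear_cinner])

lemma orthogonal_dense_eq_0:
  fixes X :: "'h::chilbert_space set"
  assumes "closure (cvec.span X) = UNIV" "\<And>y. y \<in> X \<Longrightarrow> cinner v y = 0"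
  shows "v = 0"
proof -
  have span: "cinner v y = 0" if "y \<in> cvec.span X" for y
    using that
    by (induction rule: cvec.span_induct_alt)
      (auto simp: cinner_add_right cinner_scaleC_right assms(2))
  have "v \<in> closure (cvec.span X)" using assms(1) by simp
  then obtain y where y: "\<And>n. y n \<in> cvec.span X" "y \<longlonglongrightarrow> v"
    by (auto simp: closure_sequential)
  have "(\<lambda>n. cinner v (y n)) \<longlonglongrightarrow> cinner v v"
    by (rule tendsto_cinner_right[OF y(2)])
  then have "cinner v v = 0"
    using span y(1) by (simp add: LIMSEQ_const_iff)
  then show ?thesis by (simp add: cinner_self)
qed

section \<open>Positive operators\<close>

lemma positive_op_Re: "positive_op S \<Longrightarrow> 0 \<le> Re (cinner x (S x))"
  by (auto simp: positive_op_def complex_nonneg_Reals_iff)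



lemma positive_op_bounded_clinear: "positive_op S \<Longrightarrow> bounded_clinear S"
  by (auto simp: positive_op_def)

text \<open>Over the complex scalars a real quadratic form forces symmetry: the form at x + y
  settles the imaginary parts, the form at x + i y the real parts.\<close>

lemma positive_op_self_adjoint:
  fixes S :: "'h::chilbert_space \<Rightarrow> 'h"
  assumes "positive_op S"
  shows "self_adjoint S"
proof -
  note lin = bounded_clinearD[OF positive_op_bounded_clinear[OF assms]]
  have im: "Im (cinner x (S x)) = 0" for x
    using assms by (auto simp: positive_op_def complex_nonneg_Reals_iff)
  have eq: "cinner x (S y) = cnj (cinner y (S x))" for x y
  proof (rule complex_eqI)
    have "Im (cinner x (S y)) + Im (cinner y (S x)) = 0"
      using im[of "x + y"] unfolding lin cinner_add_left cinner_add_right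
      by (simp add: im[of x] im[of y])
    then show "Im (cinner x (S y)) = Im (cnj (cinner y (S x)))" by simp
    show "Re (cinner x (S y)) = Re (cnj (cinner y (S x)))"
      using im[of "x + \<i> *\<^sub>C y"]
      unfolding lin cinner_add_left cinner_add_right cinner_scaleC_left cinner_scaleC_right
      by (simp add: im[of x] im[of y])
  qed
  have "cinner (S x) y = cinner x (S y)" for x y
    using eq[of x y] cinner_commute[of "S x" y] by simp
  then show ?thesis
    using positive_op_bounded_clinear[OF assms] by (simp add: self_adjoint_def)
qed

lemma self_adjointD: "self_adjoint S \<Longrightarrow> cinner (S x) y = cinner x (S y)"
  by (auto simp: self_adjoint_def)

text \<open>The form at x + r S x as a polynomial in \<open>r\<close>. A small negative
  \<open>r\<close> shows that zeros of the form lie in the kernel; r = -1/t gives the estimate for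
  maximising sequences.\<close>

lemma positive_op_perturb:
  assumes S: "positive_op S"
  shows "0 \<le> Re (cinner x (S x)) + 2 * r * (norm (S x))\<^sup>2 + r\<^sup>2 * Re (cinner (S x) (S (S x)))"
proof -
  note lin = bounded_clinearD[OF positive_op_bounded_clinear[OF S]]
  have eq: "cinner x (S (S x)) = complex_of_real ((norm (S x))\<^sup>2)"
    by (simp add: self_adjointD[OF positive_op_self_adjoint[OF S], symmetric] cinner_self)
  show ?thesis
    using positive_op_Re[OF S, of "x + complex_of_real r *\<^sub>C S x"]
    by (simp add: lin cinner_add_left cinner_add_right cinner_scaleC_left cinner_scaleC_right
        eq cinner_self power2_eq_square algebra_simps)
qed

lemma positive_op_eq_0:
  assumes S: "positive_op S" and 0: "Re (cinner x (S x)) = 0"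
  shows "S x = 0"
proof (rule ccontr)
  assume "S x \<noteq> 0"
  define m where "m = (norm (S x))\<^sup>2"
  define K where "K = Re (cinner (S x) (S (S x)))"
  have K: "0 \<le> K" unfolding K_def by (rule positive_op_Re[OF S])
  have m: "0 < m" using \<open>S x \<noteq> 0\<close> by (simp add: m_def)
  \<comment> \<open>The linear term 2 r m wins for small negative \<open>r\<close>; this choice
    makes the sum negative for every K \<ge> 0, including K = 0.\<close>
  have "0 \<le> 2 * (- m / (K + 1)) * m + (- m / (K + 1))\<^sup>2 * K"
    using positive_op_perturb[OF S, of x "- m / (K + 1)"] 0 by (simp add: m_def K_def)
  also have "\<dots> = - m\<^sup>2 * (K + 2) / (K + 1)\<^sup>2"
  proof -
    obtain u where u: "K = u - 1" "u \<noteq> 0" using K by (metis add_diff_cancel add_nonneg_eq_0_iff zero_le_one zero_neq_one)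
    show ?thesis unfolding u(1) using u(2) by (simp add: field_simps power2_eq_square)
  qed
  also have "\<dots> < 0" using K m by (auto simp: divide_neg_pos)
  finally show False by simp
qed

section \<open>Eigenvectors of positive compact operators\<close>

lemma norm_diff_scaleC_real:
  "(norm (y - complex_of_real t *\<^sub>C z))\<^sup>2 =
     (norm (y::'h::chilbert_space))\<^sup>2 - 2 * t * Re (cinner y z) + t\<^sup>2 * (norm z)\<^sup>2"
proof -
  have "complex_of_real ((norm (y - complex_of_real t *\<^sub>C z))\<^sup>2) =
      cinner y y - t * cinner y z - t * cnj (cinner y z) + t * t * cinner z z"
    unfolding cinner_self[symmetric] cinner_diff_left cinner_diff_right cinner_scaleC_left
      cinner_scaleC_right cinner_commute[of z y] by (simp add: algebra_simps)
  also have "\<dots> = complex_of_real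
      ((norm y)\<^sup>2 - 2 * t * Re (cinner y z) + t\<^sup>2 * (norm z)\<^sup>2)"
    by (simp add: cinner_self complex_eq_iff power2_eq_square)
  finally show ?thesis by (simp only: of_real_eq_iff)
qed

text \<open>The last clause makes \<open>t\<close> the largest Rayleigh quotient on the orthogonal
  complement of \<open>B\<close>; it expresses that no larger eigenvalue is left there.\<close>

definition maximal_eigenvector :: "('h::chilbert_space \<Rightarrow> 'h) \<Rightarrow> 'h set \<Rightarrow> 'h \<Rightarrow> real \<Rightarrow> bool" where
  "maximal_eigenvector S B v t \<longleftrightarrow>
     norm v = 1 \<and> (\<forall>b\<in>B. cinner b v = 0) \<and> S v = complex_of_real t *\<^sub>C v \<and>
     (\<forall>x. (\<forall>b\<in>B. cinner b x = 0) \<longrightarrow> Re (cinner x (S x)) \<le> t * (norm x)\<^sup>2)"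

text \<open>A maximising sequence for the form on the unit sphere of the complement of
  \<open>B\<close> consists of approximate eigenvectors, and compactness of \<open>S\<close> makes a
  subsequence converge. Since \<open>B\<close> consists of eigenvectors, \<open>S\<close> preserves
  the complement.\<close>

lemma maximal_eigenvector_exists:
  fixes S :: "'h::chilbert_space \<Rightarrow> 'h"
  assumes S: "positive_op S" and cpt: "compact_op S"
    and eig: "\<And>b. b \<in> B \<Longrightarrow> \<exists>t. S b = complex_of_real t *\<^sub>C b"
    and x0: "x0 \<noteq> 0" "\<And>b. b \<in> B \<Longrightarrow> cinner b x0 = 0"
  shows "\<exists>v t. maximal_eigenvector S B v t"
proof -
  define V where "V = {x. norm x = 1 \<and> (\<forall>b\<in>B. cinner b x = 0)}"
  define q where "q x = Re (cinner x (S x))" for x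
  have sa: "self_adjoint S" by (rule positive_op_self_adjoint[OF S])
  have lin: "bounded_clinear S" by (rule positive_op_bounded_clinear[OF S])
  interpret S: bounded_linear S using lin by (simp add: bounded_clinear_def)
  have q0: "0 \<le> q x" for x unfolding q_def by (rule positive_op_Re[OF S])
  have unit: "complex_of_real (1 / norm x) *\<^sub>C x \<in> V"
    if "x \<noteq> 0" "\<forall>b\<in>B. cinner b x = 0" for x
    using that by (simp add: V_def norm_scaleC cinner_scaleC_right norm_divide)
  obtain K where K: "\<And>x. norm (S x) \<le> norm x * K"
    using S.bounded by blast
  have bdd: "bdd_above (q ` V)"
  proof (rule bdd_aboveI2)
    fix x assume "x \<in> V"
    have "q x \<le> norm (cinner x (S x))" unfolding q_def by (rule complex_Re_le_cmod)
    also have "\<dots> \<le> norm x * norm (S x)" by (rule cinner_cauchy_schwarz)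
    also have "\<dots> \<le> K" using \<open>x \<in> V\<close> K[of x] by (simp add: V_def)
    finally show "q x \<le> K" .
  qed
  define t where "t = Sup (q ` V)"
  have Vne: "V \<noteq> {}" using unit[of x0] x0 by auto
  have le: "q x \<le> t" if "x \<in> V" for x
    unfolding t_def using that bdd by (auto intro: cSup_upper)
  have ub: "q x \<le> t * (norm x)\<^sup>2" if "\<forall>b\<in>B. cinner b x = 0" for x
  proof (cases "x = 0")
    case False
    have "q (complex_of_real (1 / norm x) *\<^sub>C x) = q x / (norm x)\<^sup>2"
      by (simp add: q_def bounded_clinearD(2)[OF lin] cinner_scaleC_right cinner_scaleC_left
          power2_eq_square Re_divide_of_real flip: of_real_mult)
    with le[OF unit[OF False that]] False show ?thesis
      by (simp add: divide_le_eq)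
  qed (simp add: q_def S.zero)
  obtain x1 where x1: "x1 \<in> V" using Vne by auto
  have t0: "0 \<le> t" using le[OF x1] q0[of x1] by linarith
  show ?thesis
  \<comment> \<open>Recovering the maximising sequence from its images divides by \<open>t\<close>.
    For t = 0 the form vanishes on the complement, and every unit vector there lies in the
    kernel.\<close>
  proof (cases "t = 0")
    case True
    have "S x1 = 0"
      using le[OF x1] q0[of x1] True by (intro positive_op_eq_0[OF S]) (simp add: q_def)
    then have "maximal_eigenvector S B x1 0"
      using x1 ub True by (auto simp: maximal_eigenvector_def V_def q_def)
    then show ?thesis by blast
  next
    case False
    with t0 have t: "0 < t" by simp
    \<comment> \<open>Maximality gives q (S x) \<le> t |S x|^2; the perturbation with r = -1/t turns
      this into |S x|^2 \<le> t q x, which is inserted into |S x - t x|^2 = |S x|^2 - 2 t q x +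
      t^2.\<close>
    have near: "(norm (S x - complex_of_real t *\<^sub>C x))\<^sup>2 \<le> t * (t - q x)" if x: "x \<in> V" for x
    proof -
      have "cinner b (S x) = 0" if b: "b \<in> B" for b
      proof -
        obtain r where "S b = complex_of_real r *\<^sub>C b" using eig[OF b] by blast
        then show ?thesis
          using x b by (simp add: self_adjointD[OF sa, symmetric] cinner_scaleC_left V_def)
      qed
      then have "q (S x) \<le> t * (norm (S x))\<^sup>2" using ub by blast
      then have "q (S x) / t\<^sup>2 \<le> (norm (S x))\<^sup>2 / t"
        using t by (simp add: divide_simps power2_eq_square mult_ac)
      moreover have "0 \<le> q x + 2 * (- 1 / t) * (norm (S x))\<^sup>2 + (- 1 / t)\<^sup>2 * q (S x)"
        unfolding q_def by (rule positive_op_perturb[OF S])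
      ultimately have "(norm (S x))\<^sup>2 / t \<le> q x"
        by (simp add: power_divide)
      then have "(norm (S x))\<^sup>2 \<le> t * q x"
        using t by (simp add: divide_simps mult.commute)
      moreover have "Re (cinner (S x) x) = q x"
        by (simp add: q_def self_adjointD[OF sa])
      ultimately show ?thesis
        using x norm_diff_scaleC_real[of "S x" t x]
        by (simp add: V_def right_diff_distrib power2_eq_square[of t])
    qed
    have "\<exists>x\<in>V. t - 1 / real (Suc n) < q x" for n
      using less_cSupD[of "q ` V" "t - 1 / real (Suc n)"] Vne by (auto simp: t_def)
    then obtain X where X: "\<And>n. X n \<in> V" "\<And>n. t - 1 / real (Suc n) < q (X n)"
      by metis
    have "compact (closure (S ` cball 0 1))" using cpt by (simp add: compact_op_def)
    moreover have "S (X n) \<in> closure (S ` cball 0 1)" for n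
      using X(1)[of n] by (intro closure_subset[THEN subsetD]) (auto simp: V_def)
    ultimately obtain l r where r: "strict_mono (r::nat \<Rightarrow> nat)" "((\<lambda>n. S (X n)) \<circ> r) \<longlonglongrightarrow> l"
      using compact_imp_seq_compact[unfolded seq_compact_def] by metis
    have "(\<lambda>n. (norm (S (X n) - t *\<^sub>R X n))\<^sup>2) \<longlonglongrightarrow> 0"
    proof (rule tendsto_sandwich[OF _ _ tendsto_const])
      show "\<forall>\<^sub>F n in sequentially. (norm (S (X n) - t *\<^sub>R X n))\<^sup>2 \<le> t * (1 / real (Suc n))"
      proof (intro always_eventually allI)
        fix n
        have "t * (t - q (X n)) \<le> t * (1 / real (Suc n))"
          using X(2)[of n] t by (intro mult_left_mono) auto
        then show "(norm (S (X n) - t *\<^sub>R X n))\<^sup>2 \<le> t * (1 / real (Suc n))"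
          using near[OF X(1)[of n]] by (simp add: scaleR_scaleC)
      qed
      show "(\<lambda>n. t * (1 / real (Suc n))) \<longlonglongrightarrow> 0"
        using tendsto_mult_right[OF LIMSEQ_inverse_real_of_nat, of t] 
        by (simp add: inverse_eq_divide)
    qed simp
    then have "(\<lambda>n. norm (S (X n) - t *\<^sub>R X n)) \<longlonglongrightarrow> 0"
      using tendsto_real_sqrt by fastforce
    then have "((\<lambda>n. S (X n) - t *\<^sub>R X n) \<circ> r) \<longlonglongrightarrow> 0"
      by (intro LIMSEQ_subseq_LIMSEQ[OF _ r(1)]) (rule tendsto_norm_zero_cancel)
    \<comment> \<open>S (X n) converges along \<open>r\<close> and differs from t X n by a null
      sequence, so X n itself converges in norm.\<close>
    from tendsto_diff[OF r(2) this] have "(\<lambda>n. t *\<^sub>R X (r n)) \<longlonglongrightarrow> l"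
      by (simp add: o_def)
    from tendsto_scaleR[OF tendsto_const[of "1 / t"] this]
    have Xr: "(\<lambda>n. X (r n)) \<longlonglongrightarrow> (1 / t) *\<^sub>R l" using t by simp
    define v where "v = (1 / t) *\<^sub>R l"
    have "(\<lambda>n. norm (X (r n))) \<longlonglongrightarrow> norm v" using Xr unfolding v_def by (rule tendsto_norm)
    then have "norm v = 1" using X(1) by (simp add: V_def LIMSEQ_const_iff)
    moreover have "cinner b v = 0" if "b \<in> B" for b
      using tendsto_cinner_right[OF Xr, of b] X(1) that by (simp add: V_def v_def LIMSEQ_const_iff)
    moreover have "S v = l"
      using S.tendsto[OF Xr] r(2) unfolding v_def by (auto simp: o_def intro: LIMSEQ_unique)
    then have "S v = complex_of_real t *\<^sub>C v" using t by (simp add: v_def flip: scaleR_scaleC)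
    ultimately have "maximal_eigenvector S B v t"
      using ub by (auto simp: maximal_eigenvector_def q_def)
    then show ?thesis by blast
  qed
qed

text \<open>Indices start at 0, and \<open>f\<close> need not span a dense subspace: vectors of the
  kernel may be missed. The last clause controls everything orthogonal to the first \<open>n\<close>
  vectors and makes \<open>s\<close> decreasing.\<close>

definition eigen_sequence :: "('h::chilbert_space \<Rightarrow> 'h) \<Rightarrow> (nat \<Rightarrow> 'h) \<Rightarrow> (nat \<Rightarrow> real) \<Rightarrow> bool" where
  "eigen_sequence S f s \<longleftrightarrow>
     orthonormal_family UNIV f \<and> (\<forall>n. S (f n) = complex_of_real (s n) *\<^sub>C f n) \<and>
     (\<forall>n x. (\<forall>j<n. cinner (f j) x = 0) \<longrightarrow> Re (cinner x (S x)) \<le> s n * (norm x)\<^sup>2)"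

lemma eigen_sequenceD:
  assumes "eigen_sequence S f s"
  shows "orthonormal_family UNIV f" "orthonormal_family I f"
    "S (f n) = complex_of_real (s n) *\<^sub>C f n"
    "(\<And>j. j < n \<Longrightarrow> cinner (f j) x = 0) \<Longrightarrow> Re (cinner x (S x)) \<le> s n * (norm x)\<^sup>2"
  using assms by (auto simp: eigen_sequence_def intro: orthonormal_family_subset)

lemma eigenvalue_conv: "norm v = 1 \<Longrightarrow> S v = complex_of_real t *\<^sub>C v \<Longrightarrow> cinner v (S v) = t"
  by (simp add: cinner_scaleC_right cinner_self)

lemma eigen_sequence_eigenvalue:
  assumes "eigen_sequence S f s"
  shows "cinner (f n) (S (f n)) = s n" "norm (f n) = 1"
proof -
  show 1: "norm (f n) = 1"
    by (rule norm_orthonormal_family[OF eigen_sequenceD(1)[OF assms]]) simp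
  show "cinner (f n) (S (f n)) = s n"
    by (rule eigenvalue_conv[of "f n" S "s n", OF 1 eigen_sequenceD(3)[OF assms]])
qed

lemma eigen_sequence_nonneg:
  assumes S: "positive_op S" and f: "eigen_sequence S f s"
  shows "0 \<le> s n"
  using positive_op_Re[OF S, of "f n"] eigen_sequence_eigenvalue[OF f] by simp

lemma eigen_sequence_antimono:
  assumes f: "eigen_sequence S f s" and "n \<le> m"
  shows "s m \<le> s n"
  using eigen_sequenceD(4)[OF f, of n "f m"] assms(2) eigen_sequence_eigenvalue[OF f]
    orthonormal_familyD[OF eigen_sequenceD(1)[OF f]]
  by simp

lemma greedy_choice:
  assumes "Q {}" and step: "\<And>B. finite B \<Longrightarrow> Q B \<Longrightarrow> \<exists>v. Q (insert v B) \<and> R B v"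
  shows "\<exists>f::nat \<Rightarrow> 'a. \<forall>n. Q (f ` {..<n}) \<and> R (f ` {..<n}) (f n)"
proof -
  \<comment> \<open>The invariant is a premise here because the choice principle asks for a next
    element after any history, also one violating \<open>Q\<close>. Induction removes the premise
    afterwards.\<close>
  let ?P = "\<lambda>(f::nat \<Rightarrow> 'a) n v.
    Q (f ` {..<n}) \<longrightarrow> Q (insert v (f ` {..<n})) \<and> R (f ` {..<n}) v"
  have "\<exists>f. \<forall>n. ?P f n (f n)"
  proof (rule dependent_wf_choice[of less_than])
    fix f g :: "nat \<Rightarrow> 'a" and n v
    assume "\<And>z. (z, n) \<in> less_than \<Longrightarrow> f z = g z"
    then have "f ` {..<n} = g ` {..<n}" by auto
    then show "?P f n v = ?P g n v" by simp
  qed (use step in auto)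
  then obtain f where f: "\<And>n. ?P f n (f n)" by blast
  have "Q (f ` {..<n})" for n
    by (induction n) (use f \<open>Q {}\<close> in \<open>auto simp: lessThan_Suc\<close>)
  then show ?thesis using f by blast
qed

lemma eigen_sequence_of_greedy:
  assumes "\<And>n. \<exists>t. maximal_eigenvector S (f ` {..<n}) (f n) t"
  shows "\<exists>s. eigen_sequence S f s"
proof -
  obtain s where s: "\<And>n. maximal_eigenvector S (f ` {..<n}) (f n) (s n)" using assms by metis
  have less: "cinner (f i) (f j) = 0" if "i < j" for i j
    using s[of j] that by (auto simp: maximal_eigenvector_def)
  then have "cinner (f j) (f i) = 0" if "i < j" for i j
    using that by (subst cinner_commute) simp
  then have "orthonormal_family UNIV f"
    using s less by (auto simp: orthonormal_family_def maximal_eigenvector_def cinner_self neq_iff)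
  then show ?thesis using s by (auto simp: eigen_sequence_def maximal_eigenvector_def)
qed

text \<open>A dimension count using Bessel in both directions: if the complement of \<open>B\<close>
  were zero, card B + 1 vectors of \<open>h\<close> would each have their full norm in the
  coefficients along \<open>B\<close>, while each element of \<open>B\<close> accounts for at most
  1.\<close>

lemma orthogonal_to_finite:
  assumes h: "orthonormal_family UNIV (h :: nat \<Rightarrow> 'h::chilbert_space)"
    and B: "finite B" "orthonormal_family B (\<lambda>x::'h. x)"
  shows "\<exists>x. x \<noteq> 0 \<and> (\<forall>b\<in>B. cinner b x = 0)"
proof (rule ccontr)
  assume neg: "\<not> ?thesis"
  let ?n = "Suc (card B)"
  have "residual B (\<lambda>x. x) (h i) = 0" for i
    using neg residual_orthogonal[OF B(2,1)] by blast
  then have "(\<Sum>b\<in>B. (norm (cinner b (h i)))\<^sup>2) = 1" for i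
    using norm_residual[OF B(2,1), of "h i"] norm_orthonormal_family[OF h] by simp
  then have "real ?n = (\<Sum>i<?n. \<Sum>b\<in>B. (norm (cinner b (h i)))\<^sup>2)" by simp
  also have "\<dots> = (\<Sum>b\<in>B. \<Sum>i<?n. (norm (cinner (h i) b))\<^sup>2)"
    by (subst sum.swap) (simp add: norm_cinner_commute)
  also have "\<dots> \<le> (\<Sum>b\<in>B. 1)"
  proof (rule sum_mono)
    fix b assume "b \<in> B"
    then show "(\<Sum>i<?n. (norm (cinner (h i) b))\<^sup>2) \<le> 1"
      using bessel[OF orthonormal_family_subset[OF h], of "{..<?n}" b]
        norm_orthonormal_family[OF B(2)] by simp
  qed
  finally show False by simp
qed

text \<open>The orthonormal sequence \<open>h\<close> witnesses infinite dimension, so the greedy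
  choice never runs out of vectors.\<close>

lemma eigen_sequence_exists:
  fixes S :: "'h::chilbert_space \<Rightarrow> 'h"
  assumes S: "positive_op S" "compact_op S"
    and h: "orthonormal_family UNIV (h :: nat \<Rightarrow> 'h)"
  shows "\<exists>f s. eigen_sequence S f s"
proof -
  let ?Q = "\<lambda>B. orthonormal_family B (\<lambda>x. x) \<and> (\<forall>b\<in>B. \<exists>t. S b = complex_of_real t *\<^sub>C b)"
  let ?R = "\<lambda>B v. \<exists>t. maximal_eigenvector S B v t"
  have "\<exists>f::nat \<Rightarrow> 'h. \<forall>n. ?Q (f ` {..<n}) \<and> ?R (f ` {..<n}) (f n)"
  proof (rule greedy_choice)
    fix B assume "finite B" and Q: "?Q B"
    obtain x where "x \<noteq> 0" "\<forall>b\<in>B. cinner b x = 0"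
      using orthogonal_to_finite[OF h \<open>finite B\<close>] Q by blast
    then obtain v t where v: "maximal_eigenvector S B v t"
      using maximal_eigenvector_exists[OF S, of B x] Q by blast
    have "cinner v b = 0" if "b \<in> B" for b
      using v that by (subst cinner_commute) (simp add: maximal_eigenvector_def)
    then have "orthonormal_family (insert v B) (\<lambda>x. x)"
      using Q v by (auto simp: orthonormal_family_def maximal_eigenvector_def cinner_self)
    then have "?Q (insert v B)"
      using Q v by (auto simp: maximal_eigenvector_def)
    then show "\<exists>v. ?Q (insert v B) \<and> ?R B v" using v by blast
  qed (auto simp: orthonormal_family_def)
  then obtain f :: "nat \<Rightarrow> 'h" where "\<forall>n. ?Q (f ` {..<n}) \<and> ?R (f ` {..<n}) (f n)" ..
  then have "\<And>n. ?R (f ` {..<n}) (f n)" by simp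
  from eigen_sequence_of_greedy[OF this] show ?thesis by blast
qed

text \<open>The hypothesis on P_N speaks about the h_m, so the eigenvectors of \<open>T\<close> have
  to be picked from this basis. \<open>\<sigma>\<close> lists them by decreasing eigenvalue; it may
  miss indices with eigenvalue 0.\<close>

lemma eigen_sequence_of_basis:
  fixes T :: "'h::chilbert_space \<Rightarrow> 'h"
  assumes T: "positive_op T" "compact_op T" and h: "orthonormal_basis h"
    and eig: "\<And>m. \<exists>t. T (h m) = complex_of_real t *\<^sub>C h m"
  shows "\<exists>\<sigma> s. inj \<sigma> \<and> eigen_sequence T (h \<circ> \<sigma>) s"
proof -
  have on: "orthonormal_family UNIV h"
    using h by (auto simp: orthonormal_basis_def orthonormal_family_def)
  have inj: "inj h"
    using orthonormal_familyD[OF on] by (intro injI) (metis UNIV_I zero_neq_one)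
  let ?R = "\<lambda>B v. v \<in> range h \<and> (\<exists>t. maximal_eigenvector T B v t)"
  have "\<exists>f::nat \<Rightarrow> 'h. \<forall>n. f ` {..<n} \<subseteq> range h \<and> ?R (f ` {..<n}) (f n)"
  proof (rule greedy_choice)
    fix B assume B: "finite B" "B \<subseteq> range h"
    have "infinite (range h)" using inj by (simp add: finite_image_iff)
    then obtain x where x: "x \<in> range h" "x \<notin> B" using B by (metis finite_subset subsetI)
    have orth: "cinner b y = 0" if "y \<in> range h" "y \<notin> B" "b \<in> B" for y b
      using orthonormal_familyD[OF on] that B(2) by force
    have "x \<noteq> 0"
    proof
      assume "x = 0"
      with x(1) obtain i where "h i = 0" by auto
      with norm_orthonormal_family[OF on, of i] show False by simp
    qed
    then obtain v t where v: "maximal_eigenvector T B v t"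
      using maximal_eigenvector_exists[OF T, of B x] eig orth[OF x] B(2) by blast
    have "v \<noteq> 0" using v by (auto simp: maximal_eigenvector_def)
    \<comment> \<open>The maximiser \<open>v\<close> need not be a basis vector. But eigenvectors to
      different eigenvalues are orthogonal, so any \<open>h j\<close> not orthogonal to
      \<open>v\<close> shares its eigenvalue; it is outside \<open>B\<close> because
      \<open>v\<close> is orthogonal to \<open>B\<close>.\<close>
    then have "\<exists>j. cinner v (h j) \<noteq> 0"
      using orthogonal_dense_eq_0[of "range h" v] h by (auto simp: orthonormal_basis_def)
    then obtain j where "cinner v (h j) \<noteq> 0" by blast
    then have j: "cinner (h j) v \<noteq> 0" by (metis cinner_commute complex_cnj_zero)
    then have notB: "h j \<notin> B" using v by (auto simp: maximal_eigenvector_def)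
    obtain u where u: "T (h j) = complex_of_real u *\<^sub>C h j" using eig by blast
    have "u * cinner (h j) v = cinner (T (h j)) v" by (simp add: u cinner_scaleC_left)
    also have "\<dots> = t * cinner (h j) v"
      using v by (simp add: self_adjointD[OF positive_op_self_adjoint[OF T(1)]]
          cinner_scaleC_right maximal_eigenvector_def)
    finally have "u = t" using j by simp
    then have "maximal_eigenvector T B (h j) t"
      using v u orth[of "h j"] notB norm_orthonormal_family[OF on]
      by (auto simp: maximal_eigenvector_def)
    then show "\<exists>v. insert v B \<subseteq> range h \<and> ?R B v" using B(2) by blast
  qed auto
  then obtain f :: "nat \<Rightarrow> 'h" where "\<forall>n. f ` {..<n} \<subseteq> range h \<and> ?R (f ` {..<n}) (f n)" ..
  then have f: "\<And>n. f n \<in> range h" "\<And>n. \<exists>t. maximal_eigenvector T (f ` {..<n}) (f n) t"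
    by simp_all
  from eigen_sequence_of_greedy[OF f(2)] obtain s where s: "eigen_sequence T f s" ..
  have "\<forall>n. \<exists>m. f n = h m" using f(1) by auto
  from choice[OF this] obtain \<sigma> where "\<forall>n. f n = h (\<sigma> n)" ..
  then have \<sigma>: "f = h \<circ> \<sigma>" by auto
  have "inj f"
    using orthonormal_familyD[OF eigen_sequenceD(1)[OF s]]
    by (intro injI) (metis UNIV_I zero_neq_one)
  then have "inj \<sigma>" unfolding \<sigma> by (rule inj_on_imageI2)
  then show ?thesis using s \<sigma> by blast
qed

section \<open>Singular values\<close>

lemma cadjoint_self_adjoint:
  assumes "self_adjoint S"
  shows "cadjoint S = S"
  unfolding cadjoint_def
proof (rule the_equality)
  show "\<forall>x y. cinner (S x) y = cinner x (S y)" using self_adjointD[OF assms] by blast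
next
  fix R assume R: "\<forall>x y. cinner (R x) y = cinner x (S y)"
  show "R = S"
  proof (rule ext, rule cinner_ext)
    fix x z
    have "cinner (R x) z = cinner (S x) z" using R self_adjointD[OF assms] by simp
    then show "cinner z (R x) = cinner z (S x)" by (metis cinner_commute)
  qed
qed

text \<open>\<open>singular_value\<close> sees only the square of \<open>S\<close>. The vector w = S
  v - t v satisfies S w = - t w, which positivity excludes unless w = 0; so no square root has to be
  taken.\<close>

lemma positive_op_square_eigenvector:
  assumes S: "positive_op S" and v: "S (S v) = (t\<^sup>2) *\<^sub>R v" and t: "0 < t"
  shows "S v = complex_of_real t *\<^sub>C v"
proof -
  note lin = bounded_clinearD[OF positive_op_bounded_clinear[OF S]]
  define w where "w = S v - complex_of_real t *\<^sub>C v"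
  have "S w = complex_of_real (- t) *\<^sub>C w"
    by (simp add: w_def lin v scaleR_scaleC scaleC_scaleC power2_eq_square
        cvec.scale_right_diff_distrib)
  then have "cinner w (S w) = - t * (norm w)\<^sup>2"
    by (simp only: cinner_scaleC_right cinner_self of_real_mult)
  with positive_op_Re[OF S, of w] have "t * (norm w)\<^sup>2 \<le> 0" by simp
  then have "w = 0" using t by (simp add: mult_le_0_iff)
  then show ?thesis by (simp add: w_def)
qed

text \<open>The supremum is attained by f 0, ..., f n. Conversely, eigenvectors with eigenvalue
  above \<open>s n\<close> lie in the span of the first \<open>n\<close> vectors, so n + 1
  orthonormal ones cannot exist. Singular values count from 1, \<open>s\<close> from 0.\<close>

lemma singular_value_eigen_sequence:
  fixes S :: "'h::chilbert_space \<Rightarrow> 'h"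
  assumes S: "positive_op S" and f: "eigen_sequence S f s"
  shows "singular_value S (Suc n) = s n"
proof -
  let ?X = "{x. x = 0 \<or> x > 0 \<and> (\<exists>B. finite B \<and> card B = Suc n \<and> corthonormal B \<and>
                (\<forall>v\<in>B. \<exists>t\<ge>x. cadjoint S (S v) = t\<^sup>2 *\<^sub>R v))}"
  have sa: "self_adjoint S" by (rule positive_op_self_adjoint[OF S])
  note lin = bounded_clinearD[OF positive_op_bounded_clinear[OF S]]
  have on: "orthonormal_family {..<n} f" for n by (rule eigen_sequenceD(2)[OF f])
  have inj: "inj f"
    using orthonormal_familyD[OF eigen_sequenceD(1)[OF f]]
    by (intro injI) (metis UNIV_I zero_neq_one)
  have s0: "0 \<le> s m" for m by (rule eigen_sequence_nonneg[OF S f])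
  have "Sup ?X = s n"
  proof (rule cSup_eq_maximum)
    show "s n \<in> ?X"
    proof (cases "s n = 0")
      case False
      have "\<exists>t\<ge>s n. S (S v) = t\<^sup>2 *\<^sub>R v" if "v \<in> f ` {..<Suc n}" for v
      proof -
        obtain i where i: "i \<le> n" "v = f i"
          using \<open>v \<in> f ` {..<Suc n}\<close> by (metis imageE lessThan_iff less_Suc_eq_le)
        then have "S (S v) = (s i)\<^sup>2 *\<^sub>R v"
          by (simp add: eigen_sequenceD(3)[OF f] lin scaleC_scaleC scaleR_scaleC power2_eq_square)
        then show ?thesis using eigen_sequence_antimono[OF f i(1)] by blast
      qed
      moreover have "corthonormal (f ` {..<Suc n})"
        using orthonormal_familyD[OF eigen_sequenceD(1)[OF f]] inj
        by (auto simp: corthonormal_def inj_eq)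
      moreover have "card (f ` {..<Suc n}) = Suc n"
        using inj by (subst card_image) (auto intro: inj_on_subset)
      ultimately show ?thesis
        using s0[of n] False by (auto simp: cadjoint_self_adjoint[OF sa] intro!: exI[of _ "f ` {..<Suc n}"])
    qed simp
  next
    fix x assume "x \<in> ?X"
    show "x \<le> s n"
    proof (rule ccontr)
      assume "\<not> x \<le> s n"
      with s0[of n] \<open>x \<in> ?X\<close> obtain B where x: "s n < x" "0 < x" and
        B: "finite B" "card B = Suc n" "corthonormal B" "\<forall>v\<in>B. \<exists>t\<ge>x. S (S v) = t\<^sup>2 *\<^sub>R v"
        by (auto simp: cadjoint_self_adjoint[OF sa])
      have onB: "orthonormal_family B (\<lambda>x. x)"
        using B(3) by (simp add: corthonormal_def orthonormal_family_def)
      have "(\<Sum>j<n. (norm (cinner (f j) v))\<^sup>2) = 1" if v: "v \<in> B" for v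
      proof -
        define r where "r = residual {..<n} f v"
        obtain t where t: "x \<le> t" "S (S v) = t\<^sup>2 *\<^sub>R v" using B(4) v by blast
        have Sv: "S v = complex_of_real t *\<^sub>C v"
          by (rule positive_op_square_eigenvector[OF S t(2)]) (use x t in linarith)
        have fr: "cinner (f j) r = 0" if "j < n" for j
          unfolding r_def using that by (intro residual_orthogonal[OF on]) auto
        have rf: "cinner r (f j) = 0" if "j < n" for j
          using fr[OF that] by (subst cinner_commute) simp
        have rv: "cinner r v = cinner r r"
          by (subst residual_expand[of v f "{..<n}"])
            (simp add: cinner_add_right cinner_sum_right cinner_scaleC_right rf flip: r_def)
        \<comment> \<open>S v - S r lies in the span of the first \<open>n\<close> eigenvectors, to
          which \<open>r\<close> is orthogonal. Thus the form at \<open>r\<close> is t |r|^2,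
          against the bound s n |r|^2 with s n < t.\<close>
        have "cinner r (S r) = cinner r (S v)"
          by (simp add: r_def[unfolded residual_def] lin cinner_diff_right cinner_sum_right
              cinner_scaleC_right eigen_sequenceD(3)[OF f])
            (simp add: rf flip: residual_def r_def)
        then have "Re (cinner r (S r)) = t * (norm r)\<^sup>2"
          by (simp add: Sv cinner_scaleC_right rv cinner_self)
        moreover have "Re (cinner r (S r)) \<le> s n * (norm r)\<^sup>2"
          by (rule eigen_sequenceD(4)[OF f fr])
        ultimately have "(t - s n) * (norm r)\<^sup>2 \<le> 0" by (simp add: algebra_simps)
        then have "r = 0" using t x by (simp add: mult_le_0_iff)
        then show ?thesis
          using norm_residual[OF on, of n v] norm_orthonormal_family[OF onB v] by (simp add: r_def)
      qed
      then have "real (Suc n) = (\<Sum>v\<in>B. \<Sum>j<n. (norm (cinner (f j) v))\<^sup>2)"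
        using B(2) by simp
      also have "\<dots> = (\<Sum>j<n. \<Sum>v\<in>B. (norm (cinner v (f j)))\<^sup>2)"
        by (subst sum.swap) (simp add: norm_cinner_commute)
      also have "\<dots> \<le> (\<Sum>j<n. 1)"
        using bessel[OF onB B(1)] eigen_sequence_eigenvalue(2)[OF f]
        by (intro sum_mono) (metis power_one)
      finally show False by simp
    qed
  qed
  then show ?thesis by (simp only: singular_value_def)
qed

lemma gamma_seq_eigen_sequence:
  assumes S: "positive_op S" and f: "eigen_sequence S f s"
  shows "gamma_seq S k = (\<Sum>j<k. s j) / ln (1 + real k)"
proof -
  have "(\<Sum>n=1..k. singular_value S n) = (\<Sum>j<k. singular_value S (Suc j))"
    by (metis One_nat_def atLeast0LessThan atLeastLessThanSuc_atLeastAtMost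
        sum.shift_bounds_Suc_ivl)
  then show ?thesis
    by (simp add: gamma_seq_def singular_value_eigen_sequence[OF S f])
qed

section \<open>Ky Fan inequalities\<close>

definition is_projection :: "('h::chilbert_space \<Rightarrow> 'h) \<Rightarrow> bool" where
  "is_projection P \<longleftrightarrow> self_adjoint P \<and> (\<forall>x. P (P x) = P x)"

lemma is_projection_cinner:
  assumes "is_projection P"
  shows "cinner x (P x) = complex_of_real ((norm (P x))\<^sup>2)" "cinner (P x) y = cinner x (P y)"
    "cinner (P x) (P y) = cinner x (P y)" "P (P x) = P x"
proof -
  show 1: "cinner (P x) y = cinner x (P y)" "P (P x) = P x" for x y
    using assms by (auto simp: is_projection_def self_adjoint_def)
  show "cinner (P x) (P y) = cinner x (P y)" by (simp add: 1)
  show "cinner x (P x) = complex_of_real ((norm (P x))\<^sup>2)"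
    unfolding cinner_self[symmetric] by (simp add: 1)
qed

lemma norm_projection_le:
  assumes "is_projection P"
  shows "norm (P x) \<le> norm x"
proof -
  have "(norm (P x))\<^sup>2 \<le> norm x * norm (P x)"
    using cinner_cauchy_schwarz[of x "P x"]
    by (simp only: is_projection_cinner(1)[OF assms] norm_of_real abs_power2)
  then show ?thesis
    by (cases "P x = 0") (auto simp: power2_eq_square)
qed

lemma compression_positive:
  assumes T: "positive_op T" and P: "is_projection P"
  shows "positive_op (P \<circ> T \<circ> P)"
proof -
  have "bounded_clinear P" using P by (auto simp: is_projection_def self_adjoint_def)
  then have "bounded_clinear (P \<circ> T \<circ> P)"
    using positive_op_bounded_clinear[OF T] by (intro bounded_clinear_compose)
  then show ?thesis
    using T by (auto simp: positive_op_def is_projection_cinner(2)[OF P, symmetric])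
qed

lemma compression_compact:
  fixes T :: "'h::chilbert_space \<Rightarrow> 'h"
  assumes T: "compact_op T" and P: "is_projection P"
  shows "compact_op (P \<circ> T \<circ> P)"
proof -
  have lP: "bounded_clinear P" using P by (auto simp: is_projection_def self_adjoint_def)
  have lT: "bounded_clinear T" using T by (auto simp: compact_op_def)
  let ?K = "closure (T ` cball 0 1)"
  have "continuous_on ?K P"
    using lP by (simp add: bounded_clinear_def linear_continuous_on)
  then have "compact (P ` ?K)" using T by (simp add: compact_op_def compact_continuous_image)
  moreover have "(P \<circ> T \<circ> P) ` cball 0 1 \<subseteq> P ` ?K"
  proof -
    have "P x \<in> cball 0 1" if "x \<in> cball 0 1" for x
      using norm_projection_le[OF P, of x] that by simp
    then show ?thesis using closure_subset[of "T ` cball 0 1"] by fastforce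
  qed
  ultimately have "closure ((P \<circ> T \<circ> P) ` cball 0 1) \<subseteq> P ` ?K"
    by (intro closure_minimal compact_imp_closed)
  with \<open>compact (P ` ?K)\<close> have "compact (closure ((P \<circ> T \<circ> P) ` cball 0 1))"
    using compact_Int_closed[of "P ` ?K"] by (metis closed_closure inf.absorb_iff2)
  then show ?thesis
    using bounded_clinear_compose[OF bounded_clinear_compose[OF lP lT] lP]
    by (simp add: compact_op_def)
qed

text \<open>The part of \<open>x\<close> orthogonal to the first \<open>k\<close> eigenvectors is
  estimated by \<open>s k\<close>, and its norm is eliminated. The weights s j - s k are
  nonnegative, so in sums over several \<open>x\<close> upper bounds for the coefficients
  suffice.\<close>

lemma quadratic_form_le:
  assumes T: "positive_op T" and g: "eigen_sequence T g s"
  shows "Re (cinner x (T x)) \<le>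
    (\<Sum>j<k. (s j - s k) * (norm (cinner (g j) x))\<^sup>2) + s k * (norm x)\<^sup>2"
proof -
  have on: "orthonormal_family {..<k} g" by (rule eigen_sequenceD(2)[OF g])
  let ?r = "residual {..<k} g x"
  have r: "cinner (g j) ?r = 0" if "j < k" for j
    using that by (intro residual_orthogonal[OF on]) auto
  have "cinner x (T x) =
      complex_of_real (\<Sum>j<k. s j * (norm (cinner (g j) x))\<^sup>2) + cinner ?r (T ?r)"
    using cinner_quadratic_expand[OF positive_op_self_adjoint[OF T] on _ eigen_sequenceD(3)[OF g],
        of ?r "\<lambda>j. cinner (g j) x"] r
    by (simp add: residual_def)
  moreover have "Re (cinner ?r (T ?r)) \<le> s k * (norm ?r)\<^sup>2"
    by (rule eigen_sequenceD(4)[OF g r])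
  moreover have "(norm ?r)\<^sup>2 = (norm x)\<^sup>2 - (\<Sum>j<k. (norm (cinner (g j) x))\<^sup>2)"
    using norm_residual[OF on, of x] by simp
  ultimately show ?thesis
    by (simp add: sum_subtractf sum_distrib_left right_diff_distrib left_diff_distrib)
qed

lemma quadratic_form_ge:
  assumes T: "positive_op T" and g: "orthonormal_family I g" "finite I"
    and eig: "\<And>i. i \<in> I \<Longrightarrow> T (g i) = complex_of_real (s i) *\<^sub>C g i"
  shows "(\<Sum>i\<in>I. s i * (norm (cinner (g i) x))\<^sup>2) \<le> Re (cinner x (T x))"
proof -
  let ?r = "residual I g x"
  have "cinner x (T x) =
      complex_of_real (\<Sum>i\<in>I. s i * (norm (cinner (g i) x))\<^sup>2) + cinner ?r (T ?r)"
    using cinner_quadratic_expand[OF positive_op_self_adjoint[OF T] g eig,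
        of ?r "\<lambda>j. cinner (g j) x"] residual_orthogonal[OF g]
    by (simp add: residual_def)
  then show ?thesis using positive_op_Re[OF T, of ?r] by simp
qed

text \<open>The easy half of Ky Fan. It puts the sequence gamma of P T P into \<open>linfty\<close>,
  where the functionals are linear and positive.\<close>

lemma eigenvalue_sum_compression_le:
  assumes T: "positive_op T" and g: "eigen_sequence T g t" and P: "is_projection P"
    and f: "eigen_sequence (P \<circ> T \<circ> P) f s"
  shows "(\<Sum>j<k. s j) \<le> (\<Sum>j<k. t j)"
proof -
  have onf: "orthonormal_family {..<k} f" by (rule eigen_sequenceD(2)[OF f])
  have tk: "0 \<le> t k" by (rule eigen_sequence_nonneg[OF T g])
  have "(\<Sum>i<k. s i) = (\<Sum>i<k. Re (cinner (P (f i)) (T (P (f i)))))"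
    using eigen_sequence_eigenvalue(1)[OF f] by (simp add: is_projection_cinner(2)[OF P])
  also have "\<dots> \<le> (\<Sum>i<k. (\<Sum>j<k. (t j - t k) * (norm (cinner (g j) (P (f i))))\<^sup>2) + t k)"
  proof (rule sum_mono)
    fix i
    have "(norm (P (f i)))\<^sup>2 \<le> 1"
      using norm_projection_le[OF P, of "f i"] eigen_sequence_eigenvalue(2)[OF f]
      by (simp add: power_le_one)
    then have "t k * (norm (P (f i)))\<^sup>2 \<le> t k" using tk by (simp add: mult_left_le)
    then show "Re (cinner (P (f i)) (T (P (f i)))) \<le>
        (\<Sum>j<k. (t j - t k) * (norm (cinner (g j) (P (f i))))\<^sup>2) + t k"
      using quadratic_form_le[OF T g, of "P (f i)" k] by linarith
  qed
  \<comment> \<open>Exchanging the sums and moving \<open>P\<close> across turns the inner sum into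
    a Bessel sum of P (g j) along the \<open>f i\<close>.\<close>
  also have "\<dots> = (\<Sum>j<k. (t j - t k) * (\<Sum>i<k. (norm (cinner (f i) (P (g j))))\<^sup>2)) + k * t k"
  proof -
    have "norm (cinner (g j) (P (f i))) = norm (cinner (f i) (P (g j)))" for i j
      by (metis is_projection_cinner(2)[OF P] norm_cinner_commute)
    then show ?thesis
      by (simp add: sum.distrib sum_distrib_left) (rule sum.swap)
  qed
  also have "\<dots> \<le> (\<Sum>j<k. (t j - t k) * 1) + k * t k"
  proof (intro add_right_mono sum_mono mult_left_mono)
    fix j assume "j \<in> {..<k}"
    then show "0 \<le> t j - t k" using eigen_sequence_antimono[OF g, of j k] by simp
    have "(norm (P (g j)))\<^sup>2 \<le> 1"
      using norm_projection_le[OF P, of "g j"] eigen_sequence_eigenvalue(2)[OF g]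
      by (simp add: power_le_one)
    then show "(\<Sum>i<k. (norm (cinner (f i) (P (g j))))\<^sup>2) \<le> 1"
      using bessel[OF onf, of "P (g j)"] by simp
  qed
  also have "\<dots> = (\<Sum>j<k. t j)" by (simp add: sum_subtractf)
  finally show ?thesis .
qed

text \<open>With a square root $R$ of $T$ this is Ky Fan's maximum principle for $R P R$, which has the
  same singular values as $P T P$. The weights \<open>a j\<close> and \<open>b\<close> below avoid the square root.\<close>

lemma eigenvalue_sum_compression_ge:
  fixes T P :: "'h::chilbert_space \<Rightarrow> 'h"
  assumes T: "positive_op T" and P: "is_projection P"
    and f: "eigen_sequence (P \<circ> T \<circ> P) f s"
    and g: "orthonormal_family {..<k} g"
    and eig: "\<And>i. i < k \<Longrightarrow> T (g i) = complex_of_real (t i) *\<^sub>C g i"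
  shows "(\<Sum>i<k. t i * (norm (P (g i)))\<^sup>2) \<le> (\<Sum>j<k. s j)"
proof (rule field_le_epsilon)
  fix e' :: real assume "0 < e'"
  \<comment> \<open>The \<open>s j\<close> may vanish, so s j + e is used in denominators; the price
    is k e in total. The summand 1 covers k = 0.\<close>
  define e where "e = e' / (real k + 1)"
  have e: "0 < e" "real k * e \<le> e'"
    using \<open>0 < e'\<close> by (auto simp: e_def field_simps)
  let ?S = "P \<circ> T \<circ> P"
  have S: "positive_op ?S" by (rule compression_positive[OF T P])
  have on: "orthonormal_family {..<k} f" by (rule eigen_sequenceD(2)[OF f])
  have s0: "0 \<le> s j" for j by (rule eigen_sequence_nonneg[OF S f])
  have form: "cinner x (?S x) = cinner (P x) (T (P x))" for x
    by (simp add: is_projection_cinner(2)[OF P])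
  have t0: "0 \<le> t i" if "i < k" for i
    using positive_op_Re[OF T, of "g i"] norm_orthonormal_family[OF g, of i] that
    by (simp add: eig cinner_scaleC_right cinner_self)
  define c where "c i j = cinner (f j) (P (g i))" for i j
  define r where "r i = residual {..<k} f (P (g i))" for i
  \<comment> \<open>For e = 0 and \<open>R\<close> the square root of \<open>T\<close>, t i |c i
    j|^2 / s j is the squared coefficient of \<open>g i\<close> along the unit vector R P (f j) /
    sqrt (s j). These vectors are orthonormal, so column sums (\<open>a j\<close>) and row sums are
    at most 1. \<open>b\<close> estimates the remaining part, with \<open>s k\<close> in place of
    the smaller eigenvalues.\<close>
  define a where "a j = (\<Sum>i<k. t i * (norm (c i j))\<^sup>2 / (s j + e))" for j
  define b where "b = (\<Sum>i<k. t i * (norm (r i))\<^sup>2 / (s k + e))"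
  \<comment> \<open>Column sums: the form of \<open>T\<close> at P (f j) equals \<open>s j\<close>
    and dominates its part along the \<open>g i\<close>.\<close>
  have a1: "a j \<le> 1" if "j < k" for j
  proof -
    have "(\<Sum>i<k. t i * (norm (c i j))\<^sup>2) \<le> Re (cinner (P (f j)) (T (P (f j))))"
    proof -
      have "norm (c i j) = norm (cinner (g i) (P (f j)))" for i
        unfolding c_def by (metis is_projection_cinner(2)[OF P] norm_cinner_commute)
      then show ?thesis using quadratic_form_ge[OF T g _ eig, of "P (f j)"] by simp
    qed
    also have "\<dots> = s j"
      using eigen_sequence_eigenvalue(1)[OF f, of j] unfolding form by simp
    finally show ?thesis
      using e s0[of j] by (simp add: a_def flip: sum_divide_distrib)
  qed
  have weight: "(\<Sum>j<k. t i * (norm (c i j))\<^sup>2 / (s j + e)) + t i * (norm (r i))\<^sup>2 / (s k + e) \<le> 1"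
    if "i < k" for i
  proof -
    define W where "W = (\<Sum>j<k. (norm (c i j))\<^sup>2 / (s j + e)) + (norm (r i))\<^sup>2 / (s k + e)"
    define r' where "r' = complex_of_real (1 / (s k + e)) *\<^sub>C r i"
    \<comment> \<open>\<open>y\<close> imitates the inverse of P T P + e applied to P (g i), with
      \<open>s k\<close> as eigenvalue on the residual. Then <P (g i), y> = W and <y, P T P y> \<le>
      W, while \<open>T\<close> dominates its part along \<open>g i\<close>; hence t i W^2 \<le>
      W.\<close>
    define y where "y = (\<Sum>j<k. (c i j / complex_of_real (s j + e)) *\<^sub>C f j) + r'"
    have pos: "0 < s j + e" for j using e s0[of j] by linarith
    have fr: "cinner (f j) (r i) = 0" if "j < k" for j
      unfolding r_def using that by (intro residual_orthogonal[OF on]) auto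
    have rf: "cinner (r i) (f j) = 0" if "j < k" for j
      using fr[OF that] by (subst cinner_commute) simp
    have "cinner y (?S y) = complex_of_real
        (\<Sum>j<k. s j * (norm (c i j / complex_of_real (s j + e)))\<^sup>2) + cinner r' (?S r')"
      unfolding y_def
      by (rule cinner_quadratic_expand[OF positive_op_self_adjoint[OF S] on _ eigen_sequenceD(3)[OF f]])
        (auto simp: r'_def cinner_scaleC_right fr)
    then have "Re (cinner y (?S y)) =
        (\<Sum>j<k. s j * (norm (c i j))\<^sup>2 / (s j + e)\<^sup>2) + Re (cinner r' (?S r'))"
      using pos by (simp add: norm_divide power_divide del: of_real_add)
    also have "\<dots> \<le> W"
      unfolding W_def
    proof (intro add_mono sum_mono)
      fix j
      have "s j * (norm (c i j))\<^sup>2 / (s j + e)\<^sup>2 \<le> (s j + e) * (norm (c i j))\<^sup>2 / (s j + e)\<^sup>2"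
        using e by (intro divide_right_mono mult_right_mono) auto
      then show "s j * (norm (c i j))\<^sup>2 / (s j + e)\<^sup>2 \<le> (norm (c i j))\<^sup>2 / (s j + e)"
        using pos[of j] by (simp add: power2_eq_square)
    next
      have "Re (cinner r' (?S r')) \<le> s k * (norm r')\<^sup>2"
        by (rule eigen_sequenceD(4)[OF f]) (simp add: r'_def cinner_scaleC_right fr)
      also have "\<dots> \<le> (s k + e) * (norm r')\<^sup>2"
        using e by (intro mult_right_mono) auto
      also have "\<dots> = (norm (r i))\<^sup>2 / (s k + e)"
        using pos[of k] by (simp add: r'_def norm_scaleC norm_divide power2_eq_square del: of_real_add)
      finally show "Re (cinner r' (?S r')) \<le> (norm (r i))\<^sup>2 / (s k + e)" .
    qed
    finally have upper: "Re (cinner y (?S y)) \<le> W" .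
    have Pg: "P (g i) = (\<Sum>j<k. c i j *\<^sub>C f j) + r i"
      unfolding c_def r_def by (rule residual_expand)
    have "cinner (P (g i)) (f j) = cnj (c i j)" for j
      unfolding c_def by (rule cinner_commute)
    moreover have "cinner (P (g i)) (r i) = (norm (r i))\<^sup>2"
      unfolding Pg by (simp add: cinner_add_left cinner_sum_left cinner_scaleC_left fr cinner_self)
    ultimately have "cinner (P (g i)) y = complex_of_real W"
      unfolding y_def W_def r'_def
      by (simp add: cinner_add_right cinner_sum_right cinner_scaleC_right of_real_sum of_real_divide
          of_real_add[of "sum _ _"] complex_norm_square[symmetric] mult_ac
          del: of_real_power of_real_add)
    then have "cinner (g i) (P y) = complex_of_real W"
      by (simp add: is_projection_cinner(2)[OF P])
    moreover have "(\<Sum>l\<in>{i}. t l * (norm (cinner (g l) (P y)))\<^sup>2) \<le> Re (cinner (P y) (T (P y)))"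
      using that by (intro quadratic_form_ge[OF T orthonormal_family_subset[OF g]]) (auto simp: eig)
    ultimately have "t i * W\<^sup>2 \<le> W" using upper form[of y] by simp
    moreover have "0 \<le> W" unfolding W_def using pos
      by (intro add_nonneg_nonneg sum_nonneg divide_nonneg_pos) auto
    ultimately have "t i * W \<le> 1"
      by (cases "W = 0") (auto simp: power2_eq_square mult.assoc[symmetric])
    then show ?thesis by (simp add: W_def distrib_left sum_distrib_left)
  qed
  have "(\<Sum>j<k. a j) + b =
      (\<Sum>i<k. (\<Sum>j<k. t i * (norm (c i j))\<^sup>2 / (s j + e)) + t i * (norm (r i))\<^sup>2 / (s k + e))"
    unfolding a_def b_def sum.distrib by (simp, rule sum.swap)
  also have "\<dots> \<le> (\<Sum>i<k. 1)" using weight by (intro sum_mono) auto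
  finally have ab: "(\<Sum>j<k. a j) + b \<le> k" by simp
  have pos: "s j + e \<noteq> 0" for j using e s0[of j] by linarith
  have "(norm (P (g i)))\<^sup>2 = (\<Sum>j<k. (norm (c i j))\<^sup>2) + (norm (r i))\<^sup>2" for i
    unfolding c_def r_def by (rule norm_residual[OF on]) simp
  then have "(\<Sum>i<k. t i * (norm (P (g i)))\<^sup>2) =
      (\<Sum>i<k. \<Sum>j<k. t i * (norm (c i j))\<^sup>2) + (\<Sum>i<k. t i * (norm (r i))\<^sup>2)"
    by (simp add: distrib_left sum.distrib sum_distrib_left)
  also have "\<dots> = (\<Sum>j<k. (s j + e) * a j) + (s k + e) * b"
    using pos by (simp add: a_def b_def sum_distrib_left) (rule sum.swap)
  \<comment> \<open>Regrouped so that all factors are nonnegative: now a j \<le> 1 and the total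
    mass, at most \<open>k\<close>, can be inserted separately.\<close>
  also have "\<dots> = (\<Sum>j<k. (s j - s k) * a j) + (s k + e) * ((\<Sum>j<k. a j) + b)"
    by (simp add: sum_distrib_left sum.distrib sum_subtractf algebra_simps)
  also have "\<dots> \<le> (\<Sum>j<k. (s j - s k) * 1) + (s k + e) * k"
    using a1 ab eigen_sequence_antimono[OF f, of _ k] e s0[of k]
    by (intro add_mono sum_mono mult_left_mono) auto
  also have "\<dots> = (\<Sum>j<k. s j) + real k * e"
    by (simp add: sum_subtractf algebra_simps)
  also have "\<dots> \<le> (\<Sum>j<k. s j) + e'" using e by simp
  finally show "(\<Sum>i<k. t i * (norm (P (g i)))\<^sup>2) \<le> (\<Sum>j<k. s j) + e'" .
qed

section \<open>Spectral measures\<close>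

context
  fixes P :: "real set \<Rightarrow> 'h::chilbert_space \<Rightarrow> 'h"
  assumes pvm: "projection_valued_measure P"
begin

lemma pvm_projection: "B \<in> sets borel \<Longrightarrow> is_projection (P B)"
  using pvm by (auto simp: projection_valued_measure_def is_projection_def o_def fun_eq_iff)

lemma pvm_linear:
  "B \<in> sets borel \<Longrightarrow> P B (x + y) = P B x + P B y"
  "B \<in> sets borel \<Longrightarrow> P B (c *\<^sub>C x) = c *\<^sub>C P B x"
  using pvm_projection[of B]
  by (simp_all add: is_projection_def self_adjoint_def bounded_clinearD(1,2)[of "P B"])

lemma pvm_Int: "B \<in> sets borel \<Longrightarrow> C \<in> sets borel \<Longrightarrow> P B (P C x) = P (B \<inter> C) x"
  using pvm by (auto simp: projection_valued_measure_def o_def)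

lemma pvm_sums:
  "range C \<subseteq> sets borel \<Longrightarrow> disjoint_family C \<Longrightarrow> (\<lambda>i::nat. P (C i) x) sums P (\<Union>i. C i) x"
  using pvm unfolding projection_valued_measure_def by blast

text \<open>Additivity is given for sequences of sets: the constant empty family yields a convergent
  series with constant terms.\<close>

lemma pvm_empty: "P {} x = 0"
proof -
  have "(\<lambda>i::nat. P {} x) sums P {} x"
    using pvm_sums[of "\<lambda>_. {}" x] by (simp add: disjoint_family_on_def)
  then show ?thesis using summable_LIMSEQ_zero[of "\<lambda>i::nat. P {} x"]
    by (auto simp: sums_iff LIMSEQ_const_iff)
qed

lemma pvm_UNIV: "P UNIV x = x"
  using pvm by (simp add: projection_valued_measure_def)

lemma pvm_orthogonal:
  assumes "B \<in> sets borel" "C \<in> sets borel" "B \<inter> C = {}"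
  shows "cinner (P B x) (P C y) = 0"
  using assms by (simp add: is_projection_cinner(2)[OF pvm_projection] pvm_Int pvm_empty)

lemma pvm_split:
  assumes "B \<in> sets borel"
  shows "x = P B x + P (- B) x"
proof -
  define C :: "nat \<Rightarrow> real set" where "C i = (if i = 0 then B else if i = 1 then - B else {})" for i
  have "(\<lambda>i. P (C i) x) sums (\<Sum>i\<in>{0, 1}. P (C i) x)"
    by (rule sums_finite) (auto simp: C_def pvm_empty)
  moreover have "(\<lambda>i. P (C i) x) sums P (\<Union>i. C i) x"
    using assms by (intro pvm_sums) (auto simp: C_def disjoint_family_on_def)
  moreover have "(\<Union>i. C i) = UNIV"
  proof -
    have "C 0 \<union> C 1 = UNIV" by (auto simp: C_def)
    then show ?thesis by blast
  qed
  ultimately have "(\<Sum>i\<in>{0, 1}. P (C i) x) = x"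
    using sums_unique2 pvm_UNIV by fastforce
  then show ?thesis by (simp add: C_def)
qed

lemma scalar_measure_sets [simp]:
  "sets (scalar_measure P x) = sets borel" "space (scalar_measure P x) = UNIV"
  using sets.sigma_sets_eq[of "borel :: real measure"] by (auto simp: scalar_measure_def)

lemma borel_measurable_scalar_measure:
  "(f \<in> borel_measurable (scalar_measure P x)) = (f \<in> borel_measurable borel)"
  by (rule arg_cong[where f = "\<lambda>A. f \<in> A"], rule measurable_cong_sets) simp_all

text \<open>\<open>measure_of\<close> takes the intended values only if they form a measure.
  Countable additivity is the strong convergence of the projections, paired with
  \<open>x\<close>.\<close>

lemma emeasure_scalar_measure:
  assumes "B \<in> sets borel"
  shows "emeasure (scalar_measure P x) B = ennreal ((norm (P B x))\<^sup>2)"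
proof -
  have eq: "Re (cinner x (P B x)) = (norm (P B x))\<^sup>2" if "B \<in> sets borel" for B
    by (simp add: is_projection_cinner(1)[OF pvm_projection[OF that]])
  have "emeasure (scalar_measure P x) B = ennreal (Re (cinner x (P B x)))"
    unfolding scalar_measure_def
  proof (rule emeasure_measure_of_sigma)
    show "sigma_algebra UNIV (sets (borel :: real measure))"
      using sets.sigma_algebra_axioms[of "borel :: real measure"] by simp
    show "positive (sets borel) (\<lambda>B. ennreal (Re (cinner x (P B x))))"
      by (simp add: positive_def pvm_empty)
    show "countably_additive (sets borel) (\<lambda>B. ennreal (Re (cinner x (P B x))))"
      unfolding countably_additive_def
    proof (intro allI impI)
      fix C :: "nat \<Rightarrow> real set"
      assume C: "range C \<subseteq> sets borel" "disjoint_family C"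
      have "(\<lambda>i. cinner x (P (C i) x)) sums cinner x (P (\<Union>i. C i) x)"
        by (rule bounded_linear.sums[OF bounded_linear_cinner pvm_sums[OF C]])
      then have "(\<lambda>i. Re (cinner x (P (C i) x))) sums Re (cinner x (P (\<Union>i. C i) x))"
        by (rule bounded_linear.sums[OF bounded_linear_Re])
      then show "(\<Sum>i. ennreal (Re (cinner x (P (C i) x)))) =
          ennreal (Re (cinner x (P (\<Union>i. C i) x)))"
        using C(1) eq by (intro suminf_ennreal_eq) auto
    qed
  qed (use assms in simp)
  then show ?thesis by (simp only: eq[OF assms])
qed

lemma measure_scalar_measure:
  "B \<in> sets borel \<Longrightarrow> measure (scalar_measure P x) B = (norm (P B x))\<^sup>2"
  by (simp add: measure_def emeasure_scalar_measure)

lemma finite_scalar_measure: "finite_measure (scalar_measure P x)"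
  by (rule finite_measureI) (simp add: emeasure_scalar_measure)

lemma scalar_measure_projection:
  assumes B: "B \<in> sets borel"
  shows "scalar_measure P (P B x) = density (scalar_measure P x) (indicator B)"
proof (rule measure_eqI)
  fix C assume "C \<in> sets (scalar_measure P (P B x))"
  then have C: "C \<in> sets borel" by simp
  have "emeasure (density (scalar_measure P x) (indicator B)) C =
      emeasure (scalar_measure P x) (B \<inter> C)"
    using B C by (subst emeasure_density)
      (auto simp: borel_measurable_scalar_measure simp flip: indicator_inter_arith)
  then show "emeasure (scalar_measure P (P B x)) C =
      emeasure (density (scalar_measure P x) (indicator B)) C"
    using B C by (simp add: emeasure_scalar_measure pvm_Int Int_commute)
qed simp

lemma AE_scalar_measure:
  assumes "B \<in> sets borel" "P B x = x"
  shows "AE t in scalar_measure P x. t \<in> B"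
proof (rule AE_I')
  have "x = x + P (- B) x" using pvm_split[OF assms(1), of x] assms(2) by simp
  then have "P (- B) x = 0" by simp
  then show "- B \<in> null_sets (scalar_measure P x)"
    using assms(1) by (auto simp: null_sets_def emeasure_scalar_measure)
qed auto

text \<open>The scalar measure of \<open>P B x + c P (- B) x\<close> only depends on the modulus of \<open>c\<close>.\<close>

lemma pvm_polarization:
  assumes B: "B \<in> sets borel" and V: "cvec.subspace V" "P B x \<in> V" "P (- B) x \<in> V"
    and add: "\<And>u v. u \<in> V \<Longrightarrow> v \<in> V \<Longrightarrow> K (u + v) = K u + K v"
    and scale: "\<And>c v. v \<in> V \<Longrightarrow> K (c *\<^sub>C v) = c *\<^sub>C K v"
    and form: "\<And>v. v \<in> V \<Longrightarrow> cinner v (K v) = complex_of_real (\<integral>t. g t \<partial>scalar_measure P v)"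
  shows "cinner (P B x) (K (P (- B) x)) = 0"
proof -
  \<comment> \<open>\<open>V\<close> allows for an operator with a domain: it will be
    \<open>Dom\<close> for \<open>D\<close> and \<open>UNIV\<close> for \<open>T\<close>.\<close>
  define u where "u = P B x"
  define v where "v = P (- B) x"
  have uv: "u \<in> V" "v \<in> V" using V by (auto simp: u_def v_def)
  have norm: "(norm (P C (u + c *\<^sub>C v)))\<^sup>2 = (norm (P C u))\<^sup>2 + (norm c)\<^sup>2 * (norm (P C v))\<^sup>2"
    if C: "C \<in> sets borel" for C c
  proof -
    have "cinner (P C u) (P C v) = 0" "cinner (P C v) (P C u) = 0"
      unfolding u_def v_def using B C by (auto simp: pvm_Int intro!: pvm_orthogonal)
    then have "cinner (P C (u + c *\<^sub>C v)) (P C (u + c *\<^sub>C v)) =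
        cinner (P C u) (P C u) + (c * cnj c) * cinner (P C v) (P C v)"
      by (simp add: pvm_linear[OF C] cinner_add_left cinner_add_right cinner_scaleC_left
          cinner_scaleC_right)
    then have "complex_of_real ((norm (P C (u + c *\<^sub>C v)))\<^sup>2) =
        complex_of_real ((norm (P C u))\<^sup>2 + (norm c)\<^sup>2 * (norm (P C v))\<^sup>2)"
      by (simp only: cinner_self complex_norm_square[symmetric] of_real_add of_real_mult)
    then show ?thesis by (simp only: of_real_eq_iff)
  qed
  have "scalar_measure P (u + c *\<^sub>C v) = scalar_measure P (u + (- c) *\<^sub>C v)" for c
    by (rule measure_eqI) (simp_all only: scalar_measure_sets emeasure_scalar_measure norm norm_minus_cancel)
  then have eq: "cinner (u + c *\<^sub>C v) (K (u + c *\<^sub>C v)) = cinner (u + (- c) *\<^sub>C v) (K (u + (- c) *\<^sub>C v))" for c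
    using uv V(1) by (subst (1 2) form) (auto simp: cvec.subspace_add cvec.subspace_diff cvec.subspace_scale)
  have expand: "cinner (u + c *\<^sub>C v) (K (u + c *\<^sub>C v)) =
      cinner u (K u) + c * cinner u (K v) + cnj c * cinner v (K u) + cnj c * c * cinner v (K v)" for c
    using uv V(1)
    by (simp add: add scale cvec.subspace_scale cinner_add_left cinner_add_right
        cinner_scaleC_left cinner_scaleC_right algebra_simps)
  \<comment> \<open>Comparing \<open>c\<close> with \<open>- c\<close> cancels the diagonal terms; c
    = 1 and c = i give the sum and the difference of the two mixed terms.\<close>
  have "2 * (cinner u (K v) + cinner v (K u)) = 0"
    using eq[of 1] unfolding expand by (simp add: algebra_simps)
  then have 1: "cinner u (K v) + cinner v (K u) = 0" by (metis mult_eq_0_iff zero_neq_numeral)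
  have 2: "\<i> * cinner u (K v) - \<i> * cinner v (K u) = 0"
    using eq[of \<i>] unfolding expand by simp
  have "2 * cinner u (K v) = 0"
    using 1 2 by (simp add: eq_neg_iff_add_eq_0[symmetric])
  then show ?thesis by (simp add: u_def v_def)
qed

end

text \<open>No commutation of \<open>D\<close> with the projections is given;
  \<open>pvm_polarization\<close> provides the missing orthogonality. It makes the integral of t - d
  over every Borel set vanish for the scalar measure of \<open>h\<close>, so this measure is
  concentrated at \<open>d\<close>.\<close>

lemma spectral_measure_eigenvector:
  fixes D :: "'h::chilbert_space \<Rightarrow> 'h"
  assumes D: "unbounded_self_adjoint Dom D" and P: "spectral_measure Dom D P"
    and h: "h \<in> Dom" "h \<noteq> 0" "D h = c *\<^sub>C h"
  shows "\<exists>d. P {d} h = h"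
proof -
  have pvm: "projection_valued_measure P"
    and Dom: "Dom = {x. integrable (scalar_measure P x) (\<lambda>t. t\<^sup>2)}"
    and form: "\<And>x. x \<in> Dom \<Longrightarrow> cinner x (D x) = complex_of_real (\<integral>t. t \<partial>scalar_measure P x)"
    using P by (auto simp: spectral_measure_def)
  have lin: "cvec.subspace Dom" "\<And>u v. u \<in> Dom \<Longrightarrow> v \<in> Dom \<Longrightarrow> D (u + v) = D u + D v"
    "\<And>a v. v \<in> Dom \<Longrightarrow> D (a *\<^sub>C v) = a *\<^sub>C D v"
    using D by (auto simp: unbounded_self_adjoint_def)
  \<comment> \<open>The mean of the normalised scalar measure of \<open>h\<close>; it equals the
    eigenvalue \<open>c\<close>, which is therefore real.\<close>
  define d where "d = (\<integral>t. t \<partial>scalar_measure P h) / (norm h)\<^sup>2"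
  have c: "c = complex_of_real d"
    using form[OF h(1)] h(2) by (simp add: h(3) cinner_scaleC_right cinner_self d_def field_simps)
  have PDom: "P B h \<in> Dom" if "B \<in> sets borel" for B
  proof -
    have "integrable (scalar_measure P h) (\<lambda>t. t\<^sup>2)" using h(1) Dom by simp
    then have "integrable (scalar_measure P h) (\<lambda>t. indicator B t *\<^sub>R t\<^sup>2)"
      using that by (intro integrable_mult_indicator) (auto simp: pvm)
    then have "integrable (density (scalar_measure P h) (\<lambda>t. ennreal (indicator B t))) (\<lambda>t. t\<^sup>2)"
      using that by (subst integrable_density) (auto simp: borel_measurable_scalar_measure[OF pvm])
    then show ?thesis
      by (simp add: Dom scalar_measure_projection[OF pvm that] ennreal_indicator)
  qed
  have mean: "(\<integral>t. (t - d) \<partial>scalar_measure P (P B h)) = 0"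
    "integrable (scalar_measure P (P B h)) (\<lambda>t. t)" if B: "B \<in> sets borel" for B
  proof -
    let ?M = "scalar_measure P (P B h)"
    interpret finite_measure ?M by (rule finite_scalar_measure[OF pvm])
    have B': "- B \<in> sets borel" using B by auto
    show int: "integrable ?M (\<lambda>t. t)"
    proof (rule Bochner_Integration.integrable_bound)
      show "integrable ?M (\<lambda>t. t\<^sup>2 + 1)"
        using PDom[OF B] by (simp add: Dom)
      have "\<bar>t\<bar> \<le> t\<^sup>2 + 1" for t :: real
      proof -
        have "0 \<le> (\<bar>t\<bar> - 1 / 2)\<^sup>2" by simp
        then show ?thesis by (simp add: power2_eq_square algebra_simps)
      qed
      then show "AE t in ?M. norm t \<le> norm (t\<^sup>2 + 1)"
        by (auto intro!: AE_I2 order_trans[OF _ abs_ge_self])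
    qed (simp add: borel_measurable_scalar_measure[OF pvm])
    \<comment> \<open>So P B h pairs with D h as with D (P B h), and the form of \<open>D\<close> at
      P B h is d |P B h|^2.\<close>
    have "cinner (P B h) (D (P (- B) h)) = 0"
      by (rule pvm_polarization[OF pvm B lin(1) PDom[OF B] PDom[OF B'] lin(2,3) form])
    moreover have "D h = D (P B h) + D (P (- B) h)"
      using lin(2)[OF PDom[OF B] PDom[OF B']] pvm_split[OF pvm B, of h] by simp
    ultimately have "cinner (P B h) (D h) = cinner (P B h) (D (P B h))"
      by (simp add: cinner_add_right)
    moreover have "cinner (P B h) (D h) = complex_of_real (d * (norm (P B h))\<^sup>2)"
      unfolding h(3) c cinner_scaleC_right is_projection_cinner(2)[OF pvm_projection[OF pvm B]]
        is_projection_cinner(1)[OF pvm_projection[OF pvm B]] of_real_mult ..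
    ultimately have "(\<integral>t. t \<partial>?M) = d * (norm (P B h))\<^sup>2"
      by (metis form[OF PDom[OF B]] of_real_eq_iff)
    moreover have "measure ?M UNIV = (norm (P B h))\<^sup>2"
      by (simp add: measure_scalar_measure[OF pvm] pvm_UNIV[OF pvm])
    ultimately show "(\<integral>t. (t - d) \<partial>?M) = 0"
      using int by (simp add: pvm)
  qed
  \<comment> \<open>\<open>\<sigma>\<close> is 1 to the right of \<open>d\<close> and -1 to the
    left: there t - d has a strict sign but integral 0.\<close>
  have zero: "P B h = 0"
    if B: "B \<in> sets borel" and g: "\<And>t. t \<in> B \<Longrightarrow> 0 < \<sigma> * (t - d)" for B and \<sigma> :: real
  proof -
    let ?M = "scalar_measure P (P B h)"
    interpret finite_measure ?M by (rule finite_scalar_measure[OF pvm])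
    have ae: "AE t in ?M. t \<in> B"
      by (rule AE_scalar_measure[OF pvm B]) (simp add: pvm_Int[OF pvm B B])
    then have nn: "AE t in ?M. 0 \<le> \<sigma> * (t - d)" using g by (auto simp: less_imp_le)
    have "integrable ?M (\<lambda>t. \<sigma> * (t - d))" using mean(2)[OF B] by simp
    moreover have "(\<integral>t. \<sigma> * (t - d) \<partial>?M) = 0" using mean(1)[OF B] by simp
    ultimately have "AE t in ?M. \<sigma> * (t - d) = 0"
      using integral_nonneg_eq_0_iff_AE nn by blast
    with ae have "AE t in ?M. False" by eventually_elim (use g in force)
    then have "UNIV \<in> null_sets ?M" by (simp add: AE_iff_null pvm)
    then show ?thesis
      by (simp add: null_sets_def emeasure_scalar_measure[OF pvm] pvm_UNIV[OF pvm])
  qed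
  have "P {d<..} h = 0" by (rule zero[of _ 1]) auto
  moreover have "P {..<d} h = 0" by (rule zero[of _ "- 1"]) auto
  ultimately have "P (- {d<..}) h = h" "P (- {..<d}) h = h"
    using pvm_split[OF pvm, of "{d<..}" h] pvm_split[OF pvm, of "{..<d}" h] by simp_all
  then have "P (- {..<d} \<inter> - {d<..}) h = h"
    by (subst pvm_Int[OF pvm, symmetric]) auto
  moreover have "- {..<d} \<inter> - {d<..} = {d}" by auto
  ultimately have "P {d} h = h" by simp
  then show ?thesis ..
qed

text \<open>The eigenvalue is \<open>G d\<close>, with \<open>d\<close> the point carrying the
  scalar measure of \<open>h\<close>. R = T - G d has vanishing form on the range of
  \<open>P {d}\<close>; R h is tested separately against this range and its complement.\<close>

lemma borel_calculus_eigenvector: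
  fixes D :: "'h::chilbert_space \<Rightarrow> 'h"
  assumes D: "unbounded_self_adjoint Dom D" and T: "has_borel_calculus Dom D G T" "positive_op T"
    and G: "G \<in> borel_measurable borel"
    and h: "h \<in> Dom" "h \<noteq> 0" "D h = c *\<^sub>C h"
  shows "\<exists>t. T h = complex_of_real t *\<^sub>C h"
proof -
  obtain P where P: "spectral_measure Dom D P"
    and form: "\<And>x. cinner x (T x) = complex_of_real (\<integral>t. G t \<partial>scalar_measure P x)"
    using T(1) by (auto simp: has_borel_calculus_def)
  have pvm: "projection_valued_measure P" using P by (simp add: spectral_measure_def)
  obtain d where d: "P {d} h = h" using spectral_measure_eigenvector[OF D P h] by blast
  note lin = bounded_clinearD[OF positive_op_bounded_clinear[OF T(2)]]
  have dm: "{d} \<in> sets borel" "- {d} \<in> sets (borel :: real measure)" by auto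
  define R where "R x = T x - complex_of_real (G d) *\<^sub>C x" for x
  have Rlin: "R (x + y) = R x + R y" "R (a *\<^sub>C x) = a *\<^sub>C R x" for x y a
    by (simp_all add: R_def lin cvec.scale_right_distrib cvec.scale_right_diff_distrib scaleC_scaleC
        mult.commute)
  have R0: "cinner y (R y) = 0" if y: "P {d} y = y" for y
  proof -
    have "(\<integral>t. G t \<partial>scalar_measure P y) = (\<integral>t. G d \<partial>scalar_measure P y)"
    proof (rule integral_cong_AE)
      show "AE t in scalar_measure P y. G t = G d"
        using AE_scalar_measure[OF pvm dm(1) y] by eventually_elim simp
    qed (use G in \<open>simp_all add: borel_measurable_scalar_measure[OF pvm]\<close>)
    also have "\<dots> = G d * (norm y)\<^sup>2"
      by (simp add: pvm measure_scalar_measure pvm_UNIV)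
    finally show ?thesis
      by (simp add: R_def cinner_diff_right cinner_scaleC_right form cinner_self)
  qed
  have "cinner z (R h) = 0" for z
  proof -
    define u where "u = P {d} z"
    define v where "v = P (- {d}) z"
    have z: "z = u + v" unfolding u_def v_def by (rule pvm_split[OF pvm dm(1)])
    have u: "P {d} u = u" unfolding u_def by (simp add: pvm_Int[OF pvm])
    have v: "P {d} v = 0" "P (- {d}) v = v"
      unfolding v_def by (simp_all add: pvm_Int[OF pvm] pvm_empty[OF pvm])
    have h': "P (- {d}) h = 0"
      using pvm_split[OF pvm dm(1), of h] d by simp
    \<comment> \<open>Applied to h + v, whose two components are exactly \<open>h\<close> and
      \<open>v\<close>.\<close>
    have "cinner (P {d} (h + v)) (T (P (- {d}) (h + v))) = 0"
      by (rule pvm_polarization[OF pvm dm(1), of UNIV _ _ G]) (simp_all add: lin form)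
    then have "cinner h (T v) = 0"
      using d v h' by (simp add: pvm_linear[OF pvm])
    then have "cinner v (T h) = 0"
      using cinner_commute[of "T v" h]
      by (simp add: self_adjointD[OF positive_op_self_adjoint[OF T(2)]])
    moreover have "cinner v h = 0"
      using pvm_orthogonal[OF pvm dm(2,1), of z h] by (simp add: v_def d)
    ultimately have vR: "cinner v (R h) = 0"
      by (simp add: R_def cinner_diff_right cinner_scaleC_right)
    \<comment> \<open>Polarization inside the range of \<open>P {d}\<close>: u + h and u + i h give
      the sum and the difference of the mixed terms.\<close>
    have "cinner (u + h) (R (u + h)) = 0" "cinner (u + \<i> *\<^sub>C h) (R (u + \<i> *\<^sub>C h)) = 0"
      using u d by (auto intro!: R0 simp: pvm_linear[OF pvm])
    then have "cinner u (R h) + cinner h (R u) = 0" "\<i> * (cinner u (R h) - cinner h (R u)) = 0"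
      using R0[OF u] R0[OF d]
      by (simp_all add: Rlin cinner_add_left cinner_add_right cinner_scaleC_left
          cinner_scaleC_right algebra_simps)
    then have "cinner u (R h) = 0" by (auto simp: eq_neg_iff_add_eq_0[symmetric])
    then show ?thesis using vR by (simp add: z cinner_add_left)
  qed
  then have "R h = 0" by (simp add: cinner_ext[of "R h" 0])
  then show ?thesis by (auto simp: R_def)
qed

section \<open>The functional of a Banach limit\<close>

lemma p_map_eq: "p_map a t = (if 1 \<le> t then a (nat \<lfloor>t\<rfloor>) else 0)"
proof (cases "1 \<le> t")
  case True
  define n where "n = nat \<lfloor>t\<rfloor> - 1"
  have n: "Suc n = nat \<lfloor>t\<rfloor>" using True by (simp add: n_def)
  have "indicator {real (Suc k)..<real (Suc k) + 1} t = (if k = n then 1 else 0 :: complex)" for k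
  proof -
    have "t \<in> {real (Suc k)..<real (Suc k) + 1} \<longleftrightarrow> \<lfloor>t\<rfloor> = int (Suc k)"
      by (simp add: floor_eq_iff)
    also have "\<dots> \<longleftrightarrow> k = n" using n True by linarith
    finally show ?thesis by (simp add: indicator_def)
  qed
  then have "p_map a t = (\<Sum>k. if k = n then a (Suc k) else 0)"
    unfolding p_map_def by (intro suminf_cong) simp
  also have "\<dots> = a (Suc n)"
    by (subst suminf_finite[of "{n}"]) auto
  finally show ?thesis using True n by simp
qed (simp add: p_map_def indicator_def)

section \<open>Bounded sequences, states and logarithmic averages\<close>

lemma linftyE:
  assumes "a \<in> linfty"
  obtains C where "\<And>k. 1 \<le> k \<Longrightarrow> norm (a k) \<le> C"
  using assms by (auto simp: linfty_def bounded_iff)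

lemma linftyI: "(\<And>k. 1 \<le> k \<Longrightarrow> norm (a k) \<le> C) \<Longrightarrow> a \<in> linfty"
  by (auto simp: linfty_def bounded_iff)

lemma linfty_add: "a \<in> linfty \<Longrightarrow> b \<in> linfty \<Longrightarrow> (\<lambda>k. a k + b k) \<in> linfty"
  unfolding linfty_def by (auto intro: bounded_plus_comp)

lemma linfty_mult:
  assumes "a \<in> linfty"
  shows "(\<lambda>k. c * a k) \<in> linfty"
proof -
  obtain C where C: "\<And>k. 1 \<le> k \<Longrightarrow> norm (a k) \<le> C" using linftyE[OF assms] by blast
  show ?thesis
    by (rule linftyI[where C = "norm c * C"]) (use C in \<open>auto simp: norm_mult intro: mult_left_mono\<close>)
qed

lemma linfty_of_real_tendsto:
  assumes "r \<longlonglongrightarrow> (0::real)"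
  shows "(\<lambda>k. complex_of_real (r k)) \<in> linfty"
proof -
  have "Bseq r" using assms by (intro convergent_imp_Bseq convergentI)
  then obtain K where "\<And>n. norm (r n) \<le> K" by (auto simp: Bseq_def)
  then show ?thesis by (intro linftyI[where C = K]) simp
qed

lemma statesD:
  assumes "\<omega> \<in> states"
  shows "a \<in> linfty \<Longrightarrow> b \<in> linfty \<Longrightarrow> \<omega> (\<lambda>k. a k + b k) = \<omega> a + \<omega> b"
    "a \<in> linfty \<Longrightarrow> \<omega> (\<lambda>k. c * a k) = c * \<omega> a"
    "a \<in> linfty \<Longrightarrow> (\<And>k. k \<ge> 1 \<Longrightarrow> a k \<in> \<real>\<^sub>\<ge>\<^sub>0) \<Longrightarrow> \<omega> a \<in> \<real>\<^sub>\<ge>\<^sub>0"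
    "\<omega> (\<lambda>k. 1) = 1"
  using assms by (auto simp: states_def)

text \<open>The sequence to which \<open>L_map\<close> applies its functional: for k \<ge> 1, entry
  \<open>k\<close> averages \<open>a\<close> over the indices from exp (k - 1) to exp k in
  logarithmic scale.\<close>

definition log_average :: "(nat \<Rightarrow> complex) \<Rightarrow> nat \<Rightarrow> complex" where
  "log_average a k = integral {real k - 1..real k} (\<lambda>t. p_map a (exp t))"

lemma L_map_eq: "L_map \<omega> a = \<omega> (log_average a)"
  by (simp add: L_map_def E_map_def[abs_def] L_inv_def[abs_def] log_average_def[abs_def])

lemma p_map_exp_bound:
  assumes "\<And>k. 1 \<le> k \<Longrightarrow> norm (a k) \<le> C" "0 \<le> C"
  shows "norm (p_map a (exp t)) \<le> C"
  using assms by (auto simp: p_map_eq le_nat_iff le_floor_iff)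

lemma p_map_exp_integrable:
  assumes "a \<in> linfty"
  shows "(\<lambda>t. p_map a (exp t)) integrable_on {u..v}"
proof -
  obtain C where C: "\<And>k. 1 \<le> k \<Longrightarrow> norm (a k) \<le> C" using linftyE[OF assms] by blast
  have C0: "0 \<le> C" using order_trans[OF norm_ge_zero C[of 1]] by simp
  have "(\<lambda>t. p_map a (exp t)) \<in> borel_measurable borel"
    unfolding p_map_eq by measurable
  then have "(\<lambda>t. p_map a (exp t)) \<in> borel_measurable (lebesgue_on {u..v})"
    by (intro measurable_restrict_space1 measurable_completion) simp
  then show ?thesis
    by (rule measurable_bounded_by_integrable_imp_integrable[OF _ integrable_const_ivl[of C]])
      (auto intro: p_map_exp_bound[OF C C0])
qed

lemma p_map_add: "p_map (\<lambda>k. a k + b k) t = p_map a t + p_map b t"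
  by (simp add: p_map_eq)

lemma log_average_add:
  "a \<in> linfty \<Longrightarrow> b \<in> linfty \<Longrightarrow>
    log_average (\<lambda>k. a k + b k) = (\<lambda>k. log_average a k + log_average b k)"
  unfolding log_average_def
  by (subst integral_add[symmetric])
    (auto intro: p_map_exp_integrable simp: p_map_add)

lemma log_average_mult: "log_average (\<lambda>k. c * a k) = (\<lambda>k. c * log_average a k)"
proof -
  have "p_map (\<lambda>k. c * a k) t = c * p_map a t" for t by (simp add: p_map_eq)
  then show ?thesis by (simp add: log_average_def fun_eq_iff)
qed

lemma log_average_le:
  assumes a: "a \<in> linfty" and C: "0 \<le> C"
    and le: "\<And>t. t \<in> {real k - 1..real k} \<Longrightarrow> norm (p_map a (exp t)) \<le> C"
  shows "norm (log_average a k) \<le> C"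
  using has_integral_bound_real[OF C finite.emptyI
      integrable_integral[OF p_map_exp_integrable[OF a, of "real k - 1" "real k"]]] le
  by (simp add: log_average_def)

lemma log_average_linfty:
  assumes "a \<in> linfty"
  shows "log_average a \<in> linfty"
proof -
  obtain C where C: "\<And>k. 1 \<le> k \<Longrightarrow> norm (a k) \<le> C" using linftyE[OF assms] by blast
  have C0: "0 \<le> C" using order_trans[OF norm_ge_zero C[of 1]] by simp
  show ?thesis
    by (rule linftyI, rule log_average_le[OF assms C0]) (rule p_map_exp_bound[OF C C0])
qed

lemma log_average_nonneg:
  assumes a: "a \<in> linfty" and nn: "\<And>k. 1 \<le> k \<Longrightarrow> a k \<in> \<real>\<^sub>\<ge>\<^sub>0"
  shows "log_average a k \<in> \<real>\<^sub>\<ge>\<^sub>0"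
proof -
  let ?f = "\<lambda>t. p_map a (exp t)"
  have int: "?f integrable_on {u..v}" for u v by (rule p_map_exp_integrable[OF a])
  have f: "?f t \<in> \<real>\<^sub>\<ge>\<^sub>0" for t
    using nn[of "nat \<lfloor>exp t\<rfloor>"] by (auto simp: p_map_eq le_nat_iff le_floor_iff)
  have "Re (integral {u..v} ?f) = integral {u..v} (\<lambda>t. Re (?f t))" for u v
    using integral_linear[OF int bounded_linear_Re] by (simp add: o_def)
  moreover have "0 \<le> integral {u..v} (\<lambda>t. Re (?f t))" for u v
    using integrable_linear[OF int bounded_linear_Re] f
    by (intro integral_nonneg) (auto simp: o_def complex_nonneg_Reals_iff)
  moreover have "Im (integral {u..v} ?f) = integral {u..v} (\<lambda>t. Im (?f t))" for u v
    using integral_linear[OF int bounded_linear_Im] by (simp add: o_def)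
  moreover have "integral {u..v} (\<lambda>t. Im (?f t)) = 0" for u v
    using f by (simp add: complex_nonneg_Reals_iff)
  ultimately show ?thesis
    by (simp add: log_average_def complex_nonneg_Reals_iff)
qed

lemma L_map_linear:
  assumes "\<omega> \<in> states"
  shows "a \<in> linfty \<Longrightarrow> b \<in> linfty \<Longrightarrow> L_map \<omega> (\<lambda>k. a k + b k) = L_map \<omega> a + L_map \<omega> b"
    "a \<in> linfty \<Longrightarrow> L_map \<omega> (\<lambda>k. c * a k) = c * L_map \<omega> a"
    "L_map \<omega> (\<lambda>k. 0) = 0"
proof -
  show "a \<in> linfty \<Longrightarrow> b \<in> linfty \<Longrightarrow> L_map \<omega> (\<lambda>k. a k + b k) = L_map \<omega> a + L_map \<omega> b"
    by (simp add: L_map_eq log_average_add statesD(1)[OF assms] log_average_linfty)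
  show scale: "L_map \<omega> (\<lambda>k. c * a k) = c * L_map \<omega> a" if "a \<in> linfty" for a c
    using that by (simp add: L_map_eq log_average_mult statesD(2)[OF assms] log_average_linfty)
  have "(\<lambda>k. 0) \<in> linfty" by (rule linftyI[where C = 0]) simp
  from scale[OF this, of 0] show "L_map \<omega> (\<lambda>k. 0) = 0" by simp
qed

lemma L_map_nonneg:
  assumes "\<omega> \<in> states" "a \<in> linfty" "\<And>k. 1 \<le> k \<Longrightarrow> a k \<in> \<real>\<^sub>\<ge>\<^sub>0"
  shows "L_map \<omega> a \<in> \<real>\<^sub>\<ge>\<^sub>0"
  unfolding L_map_eq
  by (rule statesD(3)[OF assms(1) log_average_linfty[OF assms(2)]])
    (rule log_average_nonneg[OF assms(2,3)])

text \<open>Far out, each logarithmic block averages small terms only, so the averages are small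
  from some block on. A positive translation invariant functional does not see the blocks
  before.\<close>

lemma L_map_null:
  assumes \<xi>: "\<xi> \<in> BL" and r: "\<And>k. 0 \<le> r k" "r \<longlonglongrightarrow> 0"
  shows "L_map \<xi> (\<lambda>k. complex_of_real (r k)) = 0"
proof -
  let ?a = "\<lambda>k. complex_of_real (r k)"
  have st: "\<xi> \<in> states" using \<xi> by (simp add: BL_def)
  have a: "?a \<in> linfty" by (rule linfty_of_real_tendsto[OF r(2)])
  let ?b = "log_average ?a"
  have b: "?b \<in> linfty" by (rule log_average_linfty[OF a])
  have b0: "?b k \<in> \<real>\<^sub>\<ge>\<^sub>0" for k by (rule log_average_nonneg[OF a]) (use r(1) in auto)
  have \<xi>0: "\<xi> ?b \<in> \<real>\<^sub>\<ge>\<^sub>0" using statesD(3)[OF st b] b0 by simp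
  have "Re (\<xi> ?b) \<le> \<epsilon>" if \<epsilon>: "0 < \<epsilon>" for \<epsilon>
  proof -
    obtain N where N: "\<And>k. k \<ge> N \<Longrightarrow> r k < \<epsilon>"
      using order_tendstoD(2)[OF r(2) \<epsilon>] by (auto simp: eventually_sequentially)
    \<comment> \<open>For k \<ge> 1 block k + j starts at t \<ge> N + 1, and exp t \<ge> 1 + t, so
      only indices from \<open>N\<close> on enter.\<close>
    define j where "j = Suc N"
    have small: "norm (?b (k + j)) \<le> \<epsilon>" if "k \<ge> 1" for k
    proof (rule log_average_le[OF a])
      fix t assume "t \<in> {real (k + j) - 1..real (k + j)}"
      then have "real N + 1 \<le> t" using that by (simp add: j_def)
      then have "real N + 1 \<le> exp t" using exp_ge_add_one_self[of t] by linarith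
      then have "N \<le> nat \<lfloor>exp t\<rfloor>" by (simp add: le_nat_iff le_floor_iff)
      then show "norm (p_map ?a (exp t)) \<le> \<epsilon>"
        using N[of "nat \<lfloor>exp t\<rfloor>"] r(1) \<epsilon> by (auto simp: p_map_eq)
    qed (use \<epsilon> in simp)
    have tb: "translate j ?b \<in> linfty"
      using small by (intro linftyI) (simp add: translate_def)
    have one: "(\<lambda>k. 1) \<in> linfty" by (rule linftyI[where C = 1]) simp
    have "\<xi> (\<lambda>k. complex_of_real \<epsilon> * 1 + - 1 * translate j ?b k) \<in> \<real>\<^sub>\<ge>\<^sub>0"
    proof (rule statesD(3)[OF st])
      show "(\<lambda>k. complex_of_real \<epsilon> * 1 + - 1 * translate j ?b k) \<in> linfty"
        by (intro linfty_add linfty_mult tb one)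
      fix k :: nat assume "1 \<le> k"
      then have "Re (?b (k + j)) \<le> \<epsilon>" using small complex_Re_le_cmod order_trans by blast
      then show "complex_of_real \<epsilon> * 1 + - 1 * translate j ?b k \<in> \<real>\<^sub>\<ge>\<^sub>0"
        using b0[of "k + j"] by (simp add: translate_def complex_nonneg_Reals_iff)
    qed
    also have "\<xi> (\<lambda>k. complex_of_real \<epsilon> * 1 + - 1 * translate j ?b k) =
        complex_of_real \<epsilon> - \<xi> (translate j ?b)"
      by (subst statesD(1)[OF st linfty_mult[OF one] linfty_mult[OF tb]])
        (subst (1 2) statesD(2)[OF st], simp_all add: one tb statesD(4)[OF st])
    also have "\<xi> (translate j ?b) = \<xi> ?b"
      using \<xi> b by (simp add: BL_def j_def)
    finally show ?thesis by (simp add: complex_nonneg_Reals_iff)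
  qed
  then have "Re (\<xi> ?b) \<le> 0" by (rule field_le_epsilon) simp
  then show ?thesis using \<xi>0 by (simp add: L_map_eq complex_nonneg_Reals_iff complex_eq_iff)
qed

text \<open>Positivity applied to a + r - c b. The null sequence \<open>r\<close> will absorb the
  finitely many exceptional eigenvectors.\<close>

lemma L_map_mono_null:
  fixes a b r :: "nat \<Rightarrow> real"
  assumes \<xi>: "\<xi> \<in> BL" and a: "(\<lambda>k. complex_of_real (a k)) \<in> linfty"
    and b: "(\<lambda>k. complex_of_real (b k)) \<in> linfty"
    and r: "\<And>k. 0 \<le> r k" "r \<longlonglongrightarrow> 0" and le: "\<And>k. 1 \<le> k \<Longrightarrow> c * b k - r k \<le> a k"
  shows "c * Re (L_map \<xi> (\<lambda>k. complex_of_real (b k))) \<le> Re (L_map \<xi> (\<lambda>k. complex_of_real (a k)))"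
proof -
  let ?a = "\<lambda>k. complex_of_real (a k)" and ?b = "\<lambda>k. complex_of_real (b k)"
    and ?r = "\<lambda>k. complex_of_real (r k)"
  have st: "\<xi> \<in> states" using \<xi> by (simp add: BL_def)
  have r': "?r \<in> linfty" by (rule linfty_of_real_tendsto[OF r(2)])
  have mb: "(\<lambda>k. complex_of_real (- c) * ?b k) \<in> linfty" by (rule linfty_mult[OF b])
  have "L_map \<xi> (\<lambda>k. (?a k + ?r k) + complex_of_real (- c) * ?b k) \<in> \<real>\<^sub>\<ge>\<^sub>0"
  proof (rule L_map_nonneg[OF st])
    fix k :: nat assume "1 \<le> k"
    then show "(?a k + ?r k) + complex_of_real (- c) * ?b k \<in> \<real>\<^sub>\<ge>\<^sub>0"
      using le[of k] by (simp add: complex_nonneg_Reals_iff)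
  qed (intro linfty_add a r' mb)
  also have "L_map \<xi> (\<lambda>k. (?a k + ?r k) + complex_of_real (- c) * ?b k) =
      L_map \<xi> ?a + L_map \<xi> ?r + complex_of_real (- c) * L_map \<xi> ?b"
    by (simp only: L_map_linear(1)[OF st linfty_add[OF a r'] mb] L_map_linear(1)[OF st a r']
        L_map_linear(2)[OF st b])
  finally show ?thesis
    by (simp add: L_map_null[OF \<xi> r] complex_nonneg_Reals_iff)
qed

section \<open>The Dixmier trace of a positive operator\<close>

text \<open>\<open>pos_part\<close> is a definite description, so uniqueness has to be shown. If S =
  P - N with N P = 0, the form of \<open>S\<close> at N x is minus that of \<open>N\<close> there;
  both are nonnegative, so N (N x) = 0 and thus N x = 0.\<close>

lemma pos_part_eq:
  fixes S :: "'h::chilbert_space \<Rightarrow> 'h"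
  assumes S: "positive_op S"
  shows "pos_part S = S" "pos_part (\<lambda>x. - S x) = (\<lambda>x. 0)"
proof -
  have zero: "positive_op (\<lambda>x::'h. 0::'h)"
    by (auto simp: positive_op_def intro!: bounded_clinearI[where K = 0])
  note linS = bounded_clinearD[OF positive_op_bounded_clinear[OF S]]
  have orth: "N = (\<lambda>x. 0)"
    if P: "positive_op P" and N: "positive_op N" and eq: "\<And>x. S x = P x - N x"
      and NP: "\<And>x. N (P x) = 0" for P N :: "'h \<Rightarrow> 'h"
  proof
    fix x
    have "cinner (N x) (P (N x)) = cinner x (N (P (N x)))"
      by (simp add: self_adjointD[OF positive_op_self_adjoint[OF N]])
    then have "Re (cinner (N x) (S (N x))) = - Re (cinner (N x) (N (N x)))"
      by (simp add: eq cinner_diff_right NP)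
    then have "Re (cinner (N x) (N (N x))) = 0"
      using positive_op_Re[OF S, of "N x"] positive_op_Re[OF N, of "N x"] by linarith
    then have "N (N x) = 0" by (rule positive_op_eq_0[OF N])
    then have "cinner (N x) (N x) = 0"
      by (simp add: self_adjointD[OF positive_op_self_adjoint[OF N]])
    then show "N x = 0" by (simp add: cinner_self)
  qed
  have commute: "N (P x) = 0" if P: "positive_op P" and N: "positive_op N"
    and PN: "\<And>x. P (N x) = 0" for P N :: "'h \<Rightarrow> 'h" and x
  proof (rule cinner_ext)
    fix z
    show "cinner z (N (P x)) = cinner z 0"
      using PN by (simp add: self_adjointD[OF positive_op_self_adjoint[OF N], symmetric]
          self_adjointD[OF positive_op_self_adjoint[OF P], symmetric])
  qed
  show "pos_part S = S"
    unfolding pos_part_def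
  proof (rule the_equality)
    show "positive_op S \<and> (\<exists>N. positive_op N \<and> (\<forall>x. S x = S x - N x) \<and> (\<forall>x. S (N x) = 0))"
      using S zero linS(3) by (intro conjI exI[of _ "\<lambda>x. 0"]) auto
  next
    fix P assume "positive_op P \<and> (\<exists>N. positive_op N \<and> (\<forall>x. S x = P x - N x) \<and> (\<forall>x. P (N x) = 0))"
    then obtain N where P: "positive_op P" and N: "positive_op N" and eq: "\<And>x. S x = P x - N x"
      and PN: "\<And>x. P (N x) = 0" by blast
    have "N = (\<lambda>x. 0)" by (rule orth[OF P N eq commute[OF P N PN]])
    then show "P = S" using eq by auto
  qed
  show "pos_part (\<lambda>x. - S x) = (\<lambda>x. 0)"
    unfolding pos_part_def
  proof (rule the_equality)
    show "positive_op (\<lambda>x::'h. 0::'h) \<and>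
        (\<exists>N. positive_op N \<and> (\<forall>x. - S x = 0 - N x) \<and> (\<forall>x. (0::'h) = 0))"
      using S zero by auto
  next
    fix P assume "positive_op P \<and> (\<exists>N. positive_op N \<and> (\<forall>x. - S x = P x - N x) \<and> (\<forall>x. P (N x) = 0))"
    then obtain N where P: "positive_op P" and N: "positive_op N" and eq: "\<And>x. - S x = P x - N x"
      and PN: "\<And>x. P (N x) = 0" by blast
    \<comment> \<open>The same argument with \<open>P\<close> and \<open>N\<close> exchanged; P N =
      0 is already in the required order.\<close>
    have "S x = N x - P x" for x using eq[of x] by (simp add: algebra_simps minus_equation_iff)
    then show "P = (\<lambda>x. 0)" by (rule orth[OF N P _ PN])
  qed
qed

lemma gamma_seq_zero: "gamma_seq (\<lambda>x::'h::chilbert_space. 0::'h) = (\<lambda>k. 0)"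
proof -
  have zero: "self_adjoint (\<lambda>x::'h. 0::'h)"
    by (auto simp: self_adjoint_def intro!: bounded_clinearI[where K = 0])
  \<comment> \<open>n = 0 is excluded: the empty set would qualify for every s > 0.\<close>
  have "singular_value (\<lambda>x::'h. 0::'h) n = 0" if "n \<ge> 1" for n
  proof -
    have "{s. s = 0 \<or> s > 0 \<and> (\<exists>B. finite B \<and> card B = n \<and> corthonormal B \<and>
        (\<forall>v\<in>B. \<exists>t\<ge>s. (0::'h) = t\<^sup>2 *\<^sub>R v))} = {0::real}"
    proof -
      have False if B: "s > 0" "card B = n" "corthonormal B"
        "\<forall>v\<in>B. \<exists>t\<ge>s. (0::'h) = t\<^sup>2 *\<^sub>R v" for s :: real and B
      proof -
        have "B \<noteq> {}" using B(2) \<open>n \<ge> 1\<close> by auto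
        then obtain v where v: "v \<in> B" by blast
        then obtain t where "t \<ge> s" "0 = t\<^sup>2 *\<^sub>R v" using B(4) by blast
        then have "v = 0" using B(1) by auto
        then show False using B(3) v by (force simp: corthonormal_def)
      qed
      then show ?thesis by auto
    qed
    then show ?thesis by (simp add: singular_value_def cadjoint_self_adjoint[OF zero])
  qed
  then show ?thesis by (simp add: gamma_seq_def fun_eq_iff)
qed

text \<open>The three other terms of the trace are \<omega> of the zero sequence, whence the
  assumption on \<omega>.\<close>

lemma dixmier_trace_positive:
  fixes S :: "'h::chilbert_space \<Rightarrow> 'h"
  assumes S: "positive_op S" and \<omega>: "\<omega> (\<lambda>k. 0) = 0"
  shows "dixmier_trace \<omega> S = \<omega> (\<lambda>k. of_real (gamma_seq S k))"
proof -
  have "cadjoint S = S" by (rule cadjoint_self_adjoint[OF positive_op_self_adjoint[OF S]])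
  moreover have "(1 / 2) *\<^sub>C (S x + S x) = S x" for x
    by (simp add: scaleC_add_right scaleC_one flip: scaleC_add_left)
  ultimately have "re_part S = S" "im_part S = (\<lambda>x. 0)"
    by (simp_all add: re_part_def im_part_def)
  moreover have "positive_op (\<lambda>x::'h. 0::'h)"
    by (auto simp: positive_op_def intro!: bounded_clinearI[where K = 0])
  ultimately show ?thesis
    using pos_part_eq(1)[of "\<lambda>x::'h. 0::'h"]
    by (simp add: dixmier_trace_def pos_part_eq[OF S] gamma_seq_zero \<omega>)
qed

section \<open>Multiplication by indicator functions\<close>

context
  fixes \<mu> :: "'f measure" and U :: "'h::chilbert_space \<Rightarrow> 'f \<Rightarrow> complex"
  assumes U: "unitary_onto_L2 \<mu> U"
begin

abbreviation (input) mult_indicator :: "'f set \<Rightarrow> 'h \<Rightarrow> 'h" where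
  "mult_indicator J \<equiv> mult_op \<mu> U (indicator J)"

lemma unitary_measurable [measurable]: "U v \<in> borel_measurable \<mu>"
  using U by (auto simp: unitary_onto_L2_def L2_fun_def)

lemma unitary_cnj_measurable [measurable]: "(\<lambda>x. cnj (U v x)) \<in> borel_measurable \<mu>"
  by (rule measurable_compose[OF unitary_measurable borel_measurable_continuous_onI])
    (intro continuous_intros)

lemma unitary_cinner: "cinner v w = (\<integral>x. cnj (U v x) * U w x \<partial>\<mu>)"
  using U by (auto simp: unitary_onto_L2_def)

text \<open>\<open>U\<close> takes values in functions and is linear only up to null sets;
  injectivity is read off from the preservation of inner products.\<close>

lemma unitary_AE_inj:
  assumes "AE x in \<mu>. U v x = U w x"
  shows "v = w"
proof (rule cinner_ext)
  fix z
  show "cinner z v = cinner z w"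
    unfolding unitary_cinner
    by (rule integral_cong_AE, measurable) (use assms in \<open>auto elim: eventually_mono\<close>)
qed

lemma mult_indicator_ex:
  assumes [measurable]: "J \<in> sets \<mu>"
  shows "\<exists>w. AE x in \<mu>. U w x = indicator J x * U v x"
proof -
  have "integrable \<mu> (\<lambda>x. (norm (U v x))\<^sup>2)"
    using U by (auto simp: unitary_onto_L2_def L2_fun_def)
  then have "integrable \<mu> (\<lambda>x. (norm (indicator J x * U v x))\<^sup>2)"
    by (rule Bochner_Integration.integrable_bound)
      (auto simp: norm_mult indicator_def)
  then have "(\<lambda>x. indicator J x * U v x) \<in> L2_fun \<mu>" by (simp add: L2_fun_def)
  then show ?thesis using U by (auto simp: unitary_onto_L2_def)
qed

lemma mult_indicator_eqI:
  assumes "AE x in \<mu>. U w x = indicator J x * U v x"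
  shows "mult_indicator J v = w"
  unfolding mult_op_def
proof (rule the_equality, fact assms)
  fix w' assume "AE x in \<mu>. U w' x = indicator J x * U v x"
  with assms have "AE x in \<mu>. U w' x = U w x" by eventually_elim simp
  then show "w' = w" by (rule unitary_AE_inj)
qed

lemma mult_indicator_AE:
  assumes "J \<in> sets \<mu>"
  shows "AE x in \<mu>. U (mult_indicator J v) x = indicator J x * U v x"
  using mult_indicator_ex[OF assms, of v] mult_indicator_eqI by metis

lemma cinner_mult_indicator:
  assumes [measurable]: "J \<in> sets \<mu>"
  shows "cinner z (mult_indicator J v) = (\<integral>x. cnj (U z x) * (indicator J x * U v x) \<partial>\<mu>)"
  unfolding unitary_cinner
  by (rule integral_cong_AE, measurable)
    (use mult_indicator_AE[OF assms, of v] in \<open>auto elim: eventually_mono\<close>)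

lemma mult_indicator_symmetric:
  assumes [measurable]: "J \<in> sets \<mu>"
  shows "cinner (mult_indicator J z) v = cinner z (mult_indicator J v)"
  unfolding cinner_mult_indicator[OF assms] unitary_cinner[of "mult_indicator J z"]
  by (rule integral_cong_AE, measurable)
    (use mult_indicator_AE[OF assms, of z] in \<open>auto elim!: eventually_mono simp: indicator_def\<close>)

lemma mult_indicator_projection:
  assumes J: "J \<in> sets \<mu>"
  shows "is_projection (mult_indicator J)"
proof -
  let ?P = "mult_indicator J"
  note ae = mult_indicator_AE[OF J]
  have add: "?P (v + w) = ?P v + ?P w" for v w
  proof (rule mult_indicator_eqI)
    have "AE x in \<mu>. U (?P v + ?P w) x = U (?P v) x + U (?P w) x"
      "AE x in \<mu>. U (v + w) x = U v x + U w x"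
      using U by (auto simp: unitary_onto_L2_def)
    then show "AE x in \<mu>. U (?P v + ?P w) x = indicator J x * U (v + w) x"
      using ae[of v] ae[of w] by eventually_elim (simp add: distrib_left)
  qed
  have scale: "?P (c *\<^sub>C v) = c *\<^sub>C ?P v" for c v
  proof (rule mult_indicator_eqI)
    have "AE x in \<mu>. U (c *\<^sub>C ?P v) x = c * U (?P v) x" "AE x in \<mu>. U (c *\<^sub>C v) x = c * U v x"
      using U by (auto simp: unitary_onto_L2_def)
    then show "AE x in \<mu>. U (c *\<^sub>C ?P v) x = indicator J x * U (c *\<^sub>C v) x"
      using ae[of v] by eventually_elim simp
  qed
  have idem: "?P (?P v) = ?P v" for v
    by (rule mult_indicator_eqI) (use ae[of v] in \<open>auto elim: eventually_mono simp: indicator_def\<close>)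
  have bound: "norm (?P v) \<le> norm v * 1" for v
  proof -
    have "complex_of_real ((norm (?P v))\<^sup>2) = cinner v (?P v)"
      by (simp only: cinner_self[symmetric] mult_indicator_symmetric[OF J] idem)
    then have "(norm (?P v))\<^sup>2 \<le> norm v * norm (?P v)"
      using cinner_cauchy_schwarz[of v "?P v"] by (metis abs_power2 norm_of_real)
    then show ?thesis by (cases "?P v = 0") (auto simp: power2_eq_square)
  qed
  have "bounded_clinear ?P" by (rule bounded_clinearI[OF add scale bound])
  then show ?thesis
    by (simp add: is_projection_def self_adjoint_def mult_indicator_symmetric[OF J] idem)
qed

lemma cinner_mult_indicator_self:
  assumes [measurable]: "J \<in> sets \<mu>"
  shows "cinner v (mult_indicator J v) = complex_of_real (LINT x:J|\<mu>. (norm (U v x))\<^sup>2)"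
proof -
  have "cinner v (mult_indicator J v) =
      (\<integral>x. complex_of_real (indicator J x *\<^sub>R (norm (U v x))\<^sup>2) \<partial>\<mu>)"
    unfolding cinner_mult_indicator[OF assms]
    by (rule Bochner_Integration.integral_cong)
      (auto simp: indicator_def complex_norm_square mult.commute simp del: of_real_power)
  then show ?thesis by (simp only: set_lebesgue_integral_def integral_complex_of_real)
qed

lemma mult_indicator_Un:
  assumes "J \<in> sets \<mu>" "K \<in> sets \<mu>" "J \<inter> K = {}"
  shows "mult_indicator (J \<union> K) v = mult_indicator J v + mult_indicator K v"
proof (rule mult_indicator_eqI)
  have "AE x in \<mu>. U (mult_indicator J v + mult_indicator K v) x =
      U (mult_indicator J v) x + U (mult_indicator K v) x"
    using U by (auto simp: unitary_onto_L2_def)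
  then show "AE x in \<mu>. U (mult_indicator J v + mult_indicator K v) x = indicator (J \<union> K) x * U v x"
    using mult_indicator_AE[OF assms(1), of v] mult_indicator_AE[OF assms(2), of v]
    by eventually_elim (use assms(3) in \<open>auto simp: indicator_def\<close>)
qed

text \<open>Strong convergence, as needed for the series in \<open>tail_projection\<close>: the
  squared distance of a partial sum from the limit is the integral of |U v|^2 over the rest of the
  union, which tends to 0.\<close>

lemma mult_indicator_sums:
  fixes A :: "nat \<Rightarrow> 'f set"
  assumes A: "\<And>j. A j \<in> sets \<mu>" "disjoint_family A"
  shows "(\<lambda>j. mult_indicator (A j) v) sums mult_indicator (\<Union>j. A j) v"
proof -
  let ?E = "\<Union>j. A j"
  define B where "B n = (\<Union>j<n. A j)" for n
  have B: "B n \<in> sets \<mu>" for n using A(1) by (auto simp: B_def)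
  have E: "?E \<in> sets \<mu>" using A(1) by auto
  have part: "(\<Sum>j<n. mult_indicator (A j) v) = mult_indicator (B n) v" for n
  proof (induction n)
    case 0
    have "AE x in \<mu>. U 0 x = 0"
      using U by (auto simp: unitary_onto_L2_def dest: spec[of _ 0] spec[of _ "0::'h"])
    then have "mult_indicator {} v = 0" by (intro mult_indicator_eqI) simp
    moreover have "B 0 = {}" by (simp add: B_def)
    ultimately show ?case by (simp only: lessThan_0 sum.empty)
  next
    case (Suc n)
    have "B (Suc n) = B n \<union> A n" by (auto simp: B_def lessThan_Suc)
    moreover have "B n \<inter> A n = {}"
      using A(2) by (auto simp: B_def disjoint_family_on_def) (metis IntI UNIV_I empty_iff less_irrefl)
    ultimately show ?case using Suc B A(1) by (simp add: mult_indicator_Un)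
  qed
  let ?I = "\<lambda>J. LINT x:J|\<mu>. (norm (U v x))\<^sup>2"
  have dist: "(norm (mult_indicator (B n) v - mult_indicator ?E v))\<^sup>2 = ?I ?E - ?I (B n)" for n
  proof -
    have "B n \<union> (?E - B n) = ?E" by (auto simp: B_def)
    then have split: "mult_indicator ?E v = mult_indicator (B n) v + mult_indicator (?E - B n) v"
      using mult_indicator_Un[OF B, of "?E - B n" n v] E B by auto
    have EB: "?E - B n \<in> sets \<mu>" using E B by auto
    have "cinner v (mult_indicator ?E v) =
        cinner v (mult_indicator (B n) v) + cinner v (mult_indicator (?E - B n) v)"
      by (subst split) (rule cinner_add_right)
    then have "complex_of_real (?I ?E) = complex_of_real (?I (B n)) +
        complex_of_real ((norm (mult_indicator (?E - B n) v))\<^sup>2)"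
      unfolding is_projection_cinner(1)[OF mult_indicator_projection[OF EB], of v]
        cinner_mult_indicator_self[OF E] cinner_mult_indicator_self[OF B] .
    then have "?I ?E = ?I (B n) + (norm (mult_indicator (?E - B n) v))\<^sup>2"
      by (simp only: of_real_add[symmetric] of_real_eq_iff)
    then show ?thesis by (simp add: split norm_minus_commute)
  qed
  have "(\<lambda>n. ?I (B n)) \<longlonglongrightarrow> ?I (\<Union>n. B n)"
  proof (rule set_integral_cont_up)
    show "incseq B" by (force simp: B_def incseq_def)
    have "integrable \<mu> (\<lambda>x. (norm (U v x))\<^sup>2)"
      using U by (auto simp: unitary_onto_L2_def L2_fun_def)
    then show "set_integrable \<mu> (\<Union>n. B n) (\<lambda>x. (norm (U v x))\<^sup>2)"
      unfolding set_integrable_def using B by (intro integrable_mult_indicator) auto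
  qed (use B in auto)
  moreover have "(\<Union>n. B n) = ?E" by (auto simp: B_def)
  ultimately have "(\<lambda>n. ?I ?E - ?I (B n)) \<longlonglongrightarrow> ?I ?E - ?I ?E"
    by (intro tendsto_intros) simp
  then have "(\<lambda>n. (norm (mult_indicator (B n) v - mult_indicator ?E v))\<^sup>2) \<longlonglongrightarrow> 0"
    by (simp add: dist)
  then have "(\<lambda>n. norm (mult_indicator (B n) v - mult_indicator ?E v)) \<longlonglongrightarrow> 0"
    using tendsto_real_sqrt by fastforce
  then show ?thesis
    unfolding sums_def part by (simp add: LIM_zero_iff tendsto_norm_zero_iff)
qed

lemma tail_projection_eq:
  assumes "\<forall>j. Fs j \<in> sets \<mu>" "disjoint_family Fs"
  shows "tail_projection \<mu> U Fs N v = mult_indicator (\<Union>j\<in>{N..}. Fs j) v"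
proof -
  have "disjoint_family (\<lambda>j. Fs (N + j))"
    using assms(2) by (auto simp: disjoint_family_on_def)
  then have "(\<lambda>j. mult_indicator (Fs (N + j)) v) sums mult_indicator (\<Union>j. Fs (N + j)) v"
    using assms(1) by (intro mult_indicator_sums) auto
  moreover have "(\<Union>j. Fs (N + j)) = (\<Union>j\<in>{N..}. Fs j)"
  proof (intro equalityI subsetI)
    fix x assume "x \<in> (\<Union>j\<in>{N..}. Fs j)"
    then obtain j where "N \<le> j" "x \<in> Fs j" by auto
    then have "x \<in> Fs (N + (j - N))" by simp
    then show "x \<in> (\<Union>j. Fs (N + j))" by blast
  qed auto
  ultimately show ?thesis by (simp add: tail_projection_def sums_iff)
qed

end

section \<open>The lower bound for the Dixmier trace of a compression\<close>

text \<open>Ky Fan with the eigenvectors h (\<sigma> i), for which the diagonal entries of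
  \<open>P\<close> are at least \<open>c\<close> up to finitely many exceptions.\<close>

lemma compression_dixmier_trace_ge:
  fixes T P :: "'h::chilbert_space \<Rightarrow> 'h"
  assumes T: "positive_op T" "T \<in> L1inf" and P: "is_projection P"
    and h: "orthonormal_basis h" and eig: "\<And>m. \<exists>t. T (h m) = complex_of_real t *\<^sub>C h m"
    and c: "0 \<le> c" "\<forall>\<^sub>F m in sequentially. c \<le> Re (cinner (h m) (P (h m)))"
    and \<xi>: "\<xi> \<in> BL"
  shows "c * Re (dixmier_trace (L_map \<xi>) T) \<le> Re (dixmier_trace (L_map \<xi>) (P \<circ> T \<circ> P))"
proof -
  let ?S = "P \<circ> T \<circ> P"
  have cpt: "compact_op T" using T(2) by (simp add: L1inf_def)
  have on: "orthonormal_family UNIV h"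
    using h by (auto simp: orthonormal_basis_def orthonormal_family_def)
  obtain \<sigma> t where \<sigma>: "inj \<sigma>" and t: "eigen_sequence T (h \<circ> \<sigma>) t"
    using eigen_sequence_of_basis[OF T(1) cpt h eig] by blast
  have S: "positive_op ?S" by (rule compression_positive[OF T(1) P])
  obtain f s where s: "eigen_sequence ?S f s"
    using eigen_sequence_exists[OF S compression_compact[OF cpt P] on] by blast
  have t0: "0 \<le> t i" for i by (rule eigen_sequence_nonneg[OF T(1) t])
  have s0: "0 \<le> s i" for i by (rule eigen_sequence_nonneg[OF S s])
  obtain m0 where m0: "\<And>m. m \<ge> m0 \<Longrightarrow> c \<le> (norm (P (h m)))\<^sup>2"
    using c(2) by (auto simp: eventually_sequentially is_projection_cinner(1)[OF P])
  \<comment> \<open>\<open>\<sigma>\<close> is injective, so only finitely many positions carry an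
    index below \<open>m0\<close>, where the bound by \<open>c\<close> may fail.\<close>
  have "finite (\<sigma> -` {..<m0})" using \<sigma> by (intro finite_vimageI) auto
  then obtain n0 where n0: "\<sigma> -` {..<m0} \<subseteq> {..<n0}" by (auto simp: finite_nat_iff_bounded)
  \<comment> \<open>Bounds the deficit of the exceptional positions independently of
    \<open>k\<close>; divided by ln (1 + k) it becomes a null sequence.\<close>
  define K where "K = (\<Sum>i<n0. c * t i)"
  have K0: "0 \<le> K" using c(1) t0 by (auto simp: K_def intro: sum_nonneg)
  have lower: "c * (\<Sum>i<k. t i) - K \<le> (\<Sum>j<k. s j)" for k
  proof -
    have "c * t i \<le> t i * (norm (P (h (\<sigma> i))))\<^sup>2 + (if i < n0 then c * t i else 0)" for i
    proof (cases "i < n0")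
      case False
      then have "m0 \<le> \<sigma> i" using n0 by (meson lessThan_iff not_le subsetD vimageI)
      then have "c * t i \<le> (norm (P (h (\<sigma> i))))\<^sup>2 * t i"
        using t0 by (intro mult_right_mono m0)
      then show ?thesis using False by (simp add: mult.commute)
    qed (use t0 in simp)
    then have "c * (\<Sum>i<k. t i) \<le>
        (\<Sum>i<k. t i * (norm (P (h (\<sigma> i))))\<^sup>2 + (if i < n0 then c * t i else 0))"
      unfolding sum_distrib_left by (intro sum_mono)
    moreover have "(\<Sum>i<k. if i < n0 then c * t i else 0) \<le> K"
    proof -
      have "(\<Sum>i<k. if i < n0 then c * t i else 0) = (\<Sum>i\<in>{..<k} \<inter> {..<n0}. c * t i)"
        by (subst sum.inter_restrict) auto
      also have "\<dots> \<le> K" unfolding K_def using c(1) t0 by (intro sum_mono2) auto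
      finally show ?thesis .
    qed
    moreover have "(\<Sum>i<k. t i * (norm (P ((h \<circ> \<sigma>) i)))\<^sup>2) \<le> (\<Sum>j<k. s j)"
      by (rule eigenvalue_sum_compression_ge[OF T(1) P s eigen_sequenceD(2)[OF t] eigen_sequenceD(3)[OF t]])
    ultimately show ?thesis by (simp add: sum.distrib)
  qed
  have \<gamma>T: "gamma_seq T k = (\<Sum>j<k. t j) / ln (1 + real k)"
    and \<gamma>S: "gamma_seq ?S k = (\<Sum>j<k. s j) / ln (1 + real k)" for k
    by (rule gamma_seq_eigen_sequence[OF T(1) t] gamma_seq_eigen_sequence[OF S s])+
  obtain C where C: "\<And>k. 1 \<le> k \<Longrightarrow> gamma_seq T k \<le> C"
    using T(2) by (auto simp: L1inf_def bdd_above_def)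
  have TC: "norm (complex_of_real (gamma_seq T k)) \<le> C" if "1 \<le> k" for k
    using C[OF that] t0 by (simp only: norm_of_real) (simp add: \<gamma>T sum_nonneg)
  have "gamma_seq ?S k \<le> gamma_seq T k" for k
    unfolding \<gamma>T \<gamma>S
    by (intro divide_right_mono eigenvalue_sum_compression_le[OF T(1) t P s]) simp
  then have SC: "norm (complex_of_real (gamma_seq ?S k)) \<le> C" if "1 \<le> k" for k
    using order_trans[OF _ C[OF that]] s0 by (simp only: norm_of_real) (simp add: \<gamma>S sum_nonneg)
  have st: "\<xi> \<in> states" using \<xi> by (simp add: BL_def)
  have trace: "dixmier_trace (L_map \<xi>) R = L_map \<xi> (\<lambda>k. of_real (gamma_seq R k))"
    if "positive_op R" for R :: "'h \<Rightarrow> 'h"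
    by (rule dixmier_trace_positive[where \<omega> = "L_map \<xi>", OF that L_map_linear(3)[OF st]])
  show ?thesis
    unfolding trace[OF T(1)] trace[OF S]
  proof (rule L_map_mono_null[OF \<xi> linftyI[OF SC] linftyI[OF TC]])
    show "0 \<le> K / ln (1 + real k)" for k using K0 by simp
    have "filterlim (\<lambda>k. 1 + real k) at_top sequentially"
      by (rule filterlim_tendsto_add_at_top[OF tendsto_const filterlim_real_sequentially])
    then have "filterlim (\<lambda>k. ln (1 + real k)) at_top sequentially"
      by (rule filterlim_compose[OF ln_at_top])
    then show "(\<lambda>k. K / ln (1 + real k)) \<longlonglongrightarrow> 0"
      by (rule real_tendsto_divide_at_top[OF tendsto_const])
    show "c * gamma_seq T k - K / ln (1 + real k) \<le> gamma_seq ?S k" for k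
      using divide_right_mono[OF lower[of k], of "ln (1 + real k)"]
      by (simp add: \<gamma>T \<gamma>S diff_divide_distrib)
  qed
qed

section \<open>Failure of continuity from above\<close>

theorem proposition4p15:
  fixes Dom :: "'h::{chilbert_space, second_countable_topology} set"
    and D GD :: "'h \<Rightarrow> 'h"
    and h :: "nat \<Rightarrow> 'h"
    and G :: "real \<Rightarrow> real"
    and A :: "'n::finite \<Rightarrow> 'h \<Rightarrow> 'h"
    and F :: "'f::topological_space set"
    and \<mu> :: "'f measure"
    and U :: "'h \<Rightarrow> 'f \<Rightarrow> complex"
    and e :: "'f \<Rightarrow> real^'n"
    and Fs :: "nat \<Rightarrow> 'f set"
  assumes "unbounded_self_adjoint Dom D" and "compact_resolvent Dom D"
    and "orthonormal_basis h" and "\<forall>m. h m \<in> Dom \<and> (\<exists>c. D (h m) = c *\<^sub>C h m)"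
    and "G \<in> borel_measurable borel" and "bounded (range G)" and "\<forall>t. 0 \<le> G t"
    and "has_borel_calculus Dom D G GD"
    and "positive_op GD" and "GD \<noteq> (\<lambda>v. 0)" and "GD \<in> L1inf"
    and "\<forall>i. self_adjoint (A i)" and "\<forall>i j. A i \<circ> A j = A j \<circ> A i"
    and "closure (cvec.span (\<Union>i. range (A i))) = UNIV"
    and "joint_spectral_representation A F \<mu> U e"
    and "\<forall>j. Fs j \<in> sets \<mu>" and "disjoint_family Fs"
  shows "liminf (\<lambda>N. liminf (\<lambda>m. ereal (Re (cinner (h m) (tail_projection \<mu> U Fs N (h m))))))
         = liminf (\<lambda>N. liminf (\<lambda>m. ereal (LINT x:(\<Union>j\<in>{N..}. Fs j)|\<mu>. (norm (U (h m) x))\<^sup>2)))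
       \<and> (0 < liminf (\<lambda>N. liminf (\<lambda>m. ereal (Re (cinner (h m) (tail_projection \<mu> U Fs N (h m))))))
          \<longrightarrow> (\<forall>\<xi> \<in> BL \<inter> DL. dixmier_trace (L_map \<xi>) GD \<noteq> 0
                \<longrightarrow> \<not> is_measure_on \<mu> (nu \<mu> U GD (L_map \<xi>))))"
proof -
  have U: "unitary_onto_L2 \<mu> U"
    using assms(15) by (simp add: joint_spectral_representation_def)
  define E where "E N = (\<Union>j\<in>{N..}. Fs j)" for N
  have E: "E N \<in> sets \<mu>" for N unfolding E_def using assms(16) by (intro sets.countable_UN'') auto
  have tail: "tail_projection \<mu> U Fs N = mult_op \<mu> U (indicator (E N))" for N
    unfolding E_def by (rule ext) (rule tail_projection_eq[OF U assms(16,17)])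
  have on: "orthonormal_family UNIV h"
    using assms(3) by (auto simp: orthonormal_basis_def orthonormal_family_def)
  have eig: "\<exists>t. GD (h m) = complex_of_real t *\<^sub>C h m" for m
  proof -
    obtain c where c: "D (h m) = c *\<^sub>C h m" using assms(4) by blast
    have "h m \<noteq> 0" using norm_orthonormal_family[OF on, of m] by auto
    then show ?thesis
      using borel_calculus_eigenvector[OF assms(1,8,9,5) _ _ c] assms(4) by blast
  qed
  have "\<not> is_measure_on \<mu> (nu \<mu> U GD (L_map \<xi>))"
    if pos: "0 < liminf (\<lambda>N. liminf (\<lambda>m. ereal (Re (cinner (h m) (tail_projection \<mu> U Fs N (h m))))))"
      and \<xi>: "\<xi> \<in> BL" and nz: "dixmier_trace (L_map \<xi>) GD \<noteq> 0" for \<xi>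
  proof
    assume "is_measure_on \<mu> (nu \<mu> U GD (L_map \<xi>))"
    then obtain M where "finite_measure M" and M: "sets M = sets \<mu>"
      and nu: "\<And>J. J \<in> sets \<mu> \<Longrightarrow> nu \<mu> U GD (L_map \<xi>) J = complex_of_real (measure M J)"
      by (auto simp: is_measure_on_def)
    interpret finite_measure M by fact
    \<comment> \<open>Strictly below the iterated lower limit, so the inequality holds eventually in
      \<open>N\<close> and, for each such \<open>N\<close>, eventually in \<open>m\<close>, with the
      same \<open>c\<close>.\<close>
    obtain c where c: "0 < c" and
      lim: "ereal c < liminf (\<lambda>N. liminf (\<lambda>m. ereal (Re (cinner (h m) (tail_projection \<mu> U Fs N (h m))))))"
      using ereal_dense2[OF pos] by auto
    define \<tau> where "\<tau> = Re (dixmier_trace (L_map \<xi>) GD)"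
    have st: "\<xi> \<in> states" using \<xi> by (simp add: BL_def)
    \<comment> \<open>Positivity of the functional makes the trace of \<open>GD\<close> a
      nonnegative real, and it is nonzero by assumption.\<close>
    have \<tau>: "0 < \<tau>"
    proof -
      obtain C where C: "\<And>k. 1 \<le> k \<Longrightarrow> gamma_seq GD k \<le> C"
        using assms(11) by (auto simp: L1inf_def bdd_above_def)
      have "compact_op GD" using assms(11) by (simp add: L1inf_def)
      then obtain f s where s: "eigen_sequence GD f s"
        using eigen_sequence_exists[OF assms(9) _ on] by blast
      have \<gamma>: "0 \<le> gamma_seq GD k" for k
        using eigen_sequence_nonneg[OF assms(9) s]
        by (simp add: gamma_seq_eigen_sequence[OF assms(9) s] sum_nonneg)
      have "dixmier_trace (L_map \<xi>) GD = L_map \<xi> (\<lambda>k. of_real (gamma_seq GD k))"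
        by (rule dixmier_trace_positive[where \<omega> = "L_map \<xi>", OF assms(9) L_map_linear(3)[OF st]])
      also have "\<dots> \<in> \<real>\<^sub>\<ge>\<^sub>0"
        by (rule L_map_nonneg[OF st linftyI[where C = C]]) (use C \<gamma> in auto)
      finally show ?thesis using nz by (auto simp: \<tau>_def complex_nonneg_Reals_iff complex_eq_iff)
    qed
    have "\<forall>\<^sub>F N in sequentially. c * \<tau> \<le> measure M (E N)"
      using less_LiminfD[OF lim]
    proof eventually_elim
      case (elim N)
      let ?P = "mult_op \<mu> U (indicator (E N))"
      have "\<forall>\<^sub>F m in sequentially. c \<le> Re (cinner (h m) (?P (h m)))"
        using less_LiminfD[OF elim] by eventually_elim (simp add: tail)
      from compression_dixmier_trace_ge[OF assms(9,11) mult_indicator_projection[OF U E] assms(3)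
          eig less_imp_le[OF c] this \<xi>]
      show ?case using nu[OF E, of N] by (simp add: nu_def \<tau>_def)
    qed
    moreover have "(\<lambda>N. measure M (E N)) \<longlonglongrightarrow> measure M (\<Inter>N. E N)"
      by (rule finite_Lim_measure_decseq) (use E M in \<open>force simp: E_def decseq_def\<close>)+
    moreover have "(\<Inter>N. E N) = {}"
    proof -
      \<comment> \<open>Membership in E 0 puts \<open>x\<close> into some \<open>Fs i\<close>, and
        membership in E (Suc i) into a later set, disjoint from it.\<close>
      have False if x: "x \<in> (\<Inter>N. E N)" for x
      proof -
        obtain i where "x \<in> Fs i" using x by (auto simp: E_def)
        moreover obtain j where "j \<ge> Suc i" "x \<in> Fs j" using x by (auto simp: E_def)
        ultimately show False using disjoint_family_onD[OF assms(17), of i j] by auto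
      qed
      then show ?thesis by blast
    qed
    ultimately have "c * \<tau> \<le> 0"
      using tendsto_lowerbound[of "\<lambda>N. measure M (E N)" 0 sequentially "c * \<tau>"] by simp
    then show False using mult_pos_pos[OF c \<tau>] by linarith
  qed
  moreover have "Re (cinner (h m) (tail_projection \<mu> U Fs N (h m))) =
      (LINT x:(\<Union>j\<in>{N..}. Fs j)|\<mu>. (norm (U (h m) x))\<^sup>2)" for N m
    using cinner_mult_indicator_self[OF U E, of "h m" N] by (simp add: tail flip: E_def)
  ultimately show ?thesis by auto
qed

end
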